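(* Let $T>0$, and on a complete probability space let $(H_t)_{t\in[0,T]}$ be a continuous real-valued process, $(k_t)_{t\in[0,T]}$ a jointly measurable real-valued process of finite variation, and $(X_t)_{t\in[0,T]}$ a continuous real-valued process independent of $(H,k)$. If $X$ has conditional full support (CFS) with respect to its natural filtration (as a process in $\mathbb{R}$) and $$\inf_{t\in[0,T]}|k_t|>0\quad\text{a.s.},$$ then the process $$Z_t:=H_t+\int_0^t k_s\,\mathrm{d}X_s,\quad t\in[0,T],$$ has CFS with respect to its natural filtration, as a process in $\mathbb{R}$.
   Context: Conditional full support. Let $I\subset\mathbb{R}$ be an open interval and $(X_t)_{t\in[0,T]}$ a continuous process with values in $I$ on a complete probability space $(\Omega,\mathscr{F},\mathbf{P})$, and let $\mathbb{F}=(\mathscr{F}_t)_{t\in[0,T]}$ be a filtration. For $x\in I$, $C_x([u,v],I)$ is the set of $f\in C([u,v],I)$ with $f(u)=x$; these spaces carry the uniform topology. The support of a Borel probability measure on a separable metric space is the minimal closed set of measure one. $X$ has $\mathbb{F}$-CFS if (a) $X$ is adapted to $\mathbb{F}$, and (b) for all $t\in[0,T)$ and $\mathbf{P}$-almost all $\omega$, $\mathrm{supp}\big(\mathrm{Law}[(X_u)_{u\in[t,T]}\mid\mathscr{F}_t](\omega)\big)=C_{X_t(\omega)}([t,T],I)$, where the law is a regular conditional law on $C([t,T],I)$. Here $I=\mathbb{R}$. When no filtration is mentioned, it is the natural filtration of the process. "Jointly measurable" means $(t,\omega)\mapsto k_t(\omega)$ is $\mathscr{B}([0,T])\otimes\mathscr{F}$-measurable.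 "Of finite variation" means that the paths $t\mapsto k_t$ have finite total variation on $[0,T]$. The integral $\int_0^t k_s\,\mathrm{d}X_s$ is a pathwise Riemann–Stieltjes integral, which exists because $X$ is continuous and $k$ is of finite variation. *)

theory Defs
  imports "HOL-Probability.Probability"
begin

text \<open>\<open>C([u,v],I)\<close> with the uniform metric. Its elements are extensional functions on
  \<open>{u..v}\<close>; boundedness, which the library's \<open>cfunspace\<close> asks for, is automatic by compactness.\<close>

definition path_space :: "real set \<Rightarrow> real \<Rightarrow> real \<Rightarrow> (real \<Rightarrow> real) metric" where
  "path_space I u v = cfunspace (top_of_set {u..v}) (submetric euclidean_metric I)"

definition paths_from :: "real set \<Rightarrow> real \<Rightarrow> real \<Rightarrow> real \<Rightarrow> (real \<Rightarrow> real) set" where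
  "paths_from I u v x = {f \<in> mspace (path_space I u v). f u = x}"

definition borel_of_metric :: "'b metric \<Rightarrow> 'b measure" where
  "borel_of_metric m = sigma (mspace m) {U. openin (mtopology_of m) U}"

text \<open>\<open>S\<close> is the minimal closed set of measure one. It exists and is unique for Borel
  probability measures on separable metric spaces; the relational form avoids a default value
  elsewhere.\<close>

definition is_support :: "'b metric \<Rightarrow> 'b measure \<Rightarrow> 'b set \<Rightarrow> bool" where
  "is_support m \<mu> S \<longleftrightarrow>
     closedin (mtopology_of m) S \<and> emeasure \<mu> S = 1 \<and>
     (\<forall>C. closedin (mtopology_of m) C \<and> emeasure \<mu> C = 1 \<longrightarrow> S \<subseteq> C)"

definition continuous_process :: "'a measure \<Rightarrow> real \<Rightarrow> real set \<Rightarrow> (real \<Rightarrow> 'a \<Rightarrow> real) \<Rightarrow> bool" where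
  "continuous_process M T I X \<longleftrightarrow>
     (\<forall>t\<in>{0..T}. X t \<in> borel_measurable M) \<and>
     (\<forall>\<omega>\<in>space M. continuous_on {0..T} (\<lambda>t. X t \<omega>) \<and> (\<forall>t\<in>{0..T}. X t \<omega> \<in> I))"

definition filtration_upto :: "'a measure \<Rightarrow> real \<Rightarrow> (real \<Rightarrow> 'a measure) \<Rightarrow> bool" where
  "filtration_upto M T F \<longleftrightarrow>
     (\<forall>t\<in>{0..T}. subalgebra M (F t)) \<and>
     (\<forall>s\<in>{0..T}. \<forall>t\<in>{0..T}. s \<le> t \<longrightarrow> sets (F s) \<subseteq> sets (F t))"

text \<open>The raw natural filtration, without augmentation by null sets.\<close>

definition natural_filtration :: "'a measure \<Rightarrow> (real \<Rightarrow> 'a \<Rightarrow> real) \<Rightarrow> real \<Rightarrow> 'a measure" where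
  "natural_filtration M X t =
     sigma (space M) {X s -` A \<inter> space M | s A. s \<in> {0..t} \<and> A \<in> sets borel}"

text \<open>\<open>\<kappa>\<close> is a regular version of \<open>Law[Y | G]\<close>, for \<open>Y\<close> with values in \<open>N\<close>.\<close>

definition regular_cond_law ::
  "'a measure \<Rightarrow> 'a measure \<Rightarrow> 'b measure \<Rightarrow> ('a \<Rightarrow> 'b) \<Rightarrow> ('a \<Rightarrow> 'b measure) \<Rightarrow> bool" where
  "regular_cond_law M G N Y \<kappa> \<longleftrightarrow>
     subalgebra M G \<and> Y \<in> M \<rightarrow>\<^sub>M N \<and> \<kappa> \<in> G \<rightarrow>\<^sub>M prob_algebra N \<and>
     (\<forall>B\<in>sets N. AE \<omega> in M.
        measure (\<kappa> \<omega>) B = real_cond_exp M G (\<lambda>\<omega>'. indicator B (Y \<omega>')) \<omega>)"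

text \<open>Regular conditional laws on \<open>C([t,T],I)\<close> exist and are almost surely unique, so it does
  not matter which version \<open>\<kappa>\<close> is taken.\<close>

definition has_CFS ::
  "'a measure \<Rightarrow> real \<Rightarrow> real set \<Rightarrow> (real \<Rightarrow> 'a measure) \<Rightarrow> (real \<Rightarrow> 'a \<Rightarrow> real) \<Rightarrow> bool" where
  "has_CFS M T I F X \<longleftrightarrow>
     open I \<and> is_interval I \<and> continuous_process M T I X \<and> filtration_upto M T F \<and>
     (\<forall>t\<in>{0..T}. X t \<in> borel_measurable (F t)) \<and>
     (\<forall>t\<in>{0..<T}. \<exists>\<kappa>.
        regular_cond_law M (F t) (borel_of_metric (path_space I t T))
          (\<lambda>\<omega>. \<lambda>u\<in>{t..T}. X u \<omega>) \<kappa> \<and>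
        (AE \<omega> in M. is_support (path_space I t T) (\<kappa> \<omega>) (paths_from I t T (X t \<omega>))))"

definition finite_variation_on :: "(real \<Rightarrow> real) \<Rightarrow> real \<Rightarrow> real \<Rightarrow> bool" where
  "finite_variation_on f a b \<longleftrightarrow>
     (\<exists>B. \<forall>d. d division_of {a..b} \<longrightarrow> (\<Sum>K\<in>d. \<bar>f (Sup K) - f (Inf K)\<bar>) \<le> B)"

text \<open>Convergence of the tagged sums as the mesh tends to zero. Degenerate intervals, which
  library divisions may contain, contribute nothing.\<close>

definition has_RS_integral ::
  "(real \<Rightarrow> real) \<Rightarrow> (real \<Rightarrow> real) \<Rightarrow> real \<Rightarrow> real \<Rightarrow> real \<Rightarrow> bool" where
  "has_RS_integral f g a b L \<longleftrightarrow>
     (\<forall>\<epsilon>>0. \<exists>\<delta>>0. \<forall>p. p tagged_division_of {a..b} \<and> (\<forall>(x, K)\<in>p. Sup K - Inf K < \<delta>) \<longrightarrow>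
        \<bar>(\<Sum>(x, K)\<in>p. f x * (g (Sup K) - g (Inf K))) - L\<bar> < \<epsilon>)"

definition RS_integral :: "(real \<Rightarrow> real) \<Rightarrow> (real \<Rightarrow> real) \<Rightarrow> real \<Rightarrow> real \<Rightarrow> real" where
  "RS_integral f g a b = (THE L. has_RS_integral f g a b L)"

lemma has_RS_integral_unique:
  assumes L: "has_RS_integral f g a b L" and L': "has_RS_integral f g a b L'"
  shows "L = L'"
proof (rule ccontr)
  assume "L \<noteq> L'"
  then have pos: "\<bar>L - L'\<bar> / 2 > 0" by simp
  let ?S = "\<lambda>p. \<Sum>(x, K)\<in>p. f x * (g (Sup K) - g (Inf K))"
  obtain d where d: "d > 0" "\<And>p. p tagged_division_of {a..b} \<Longrightarrow>
      (\<forall>(x, K)\<in>p. Sup K - Inf K < d) \<Longrightarrow> \<bar>?S p - L\<bar> < \<bar>L - L'\<bar> / 2"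
    using L[unfolded has_RS_integral_def, rule_format, OF pos] by blast
  obtain d' where d': "d' > 0" "\<And>p. p tagged_division_of {a..b} \<Longrightarrow>
      (\<forall>(x, K)\<in>p. Sup K - Inf K < d') \<Longrightarrow> \<bar>?S p - L'\<bar> < \<bar>L - L'\<bar> / 2"
    using L'[unfolded has_RS_integral_def, rule_format, OF pos] by blast
  define e where "e = min d d' / 2"
  have e: "e > 0" using d(1) d'(1) by (simp add: e_def)
  obtain p where p: "p tagged_division_of {a..b}" "(\<lambda>x. ball x e) fine p"
    using fine_division_exists_real[OF gauge_ball[OF e]] by blast
  have "Sup K - Inf K < d \<and> Sup K - Inf K < d'" if xK: "(x, K) \<in> p" for x K
  proof -
    obtain u v where K: "K = {u..v}" "x \<in> K"
      using tagged_division_ofD(2,4)[OF p(1) xK] by auto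
    then have uv: "u \<le> v" by simp
    have "K \<subseteq> ball x e" using p(2) xK by (auto simp: fine_def)
    with K uv have "dist x u < e" "dist x v < e" by (auto simp: subset_iff)
    then have "v - u < 2 * e" by (auto simp: dist_real_def)
    with K uv show ?thesis by (auto simp: e_def)
  qed
  with d(2)[OF p(1)] d'(2)[OF p(1)]
  have "\<bar>?S p - L\<bar> < \<bar>L - L'\<bar> / 2" "\<bar>?S p - L'\<bar> < \<bar>L - L'\<bar> / 2" by blast+
  moreover have "\<bar>L - L'\<bar> \<le> \<bar>s - L\<bar> + \<bar>s - L'\<bar>" for s :: real by linarith
  ultimately show False by (smt (verit) field_sum_of_halves)
qed

end

theory Submission
  imports Defs
begin

text \<open>Conditional full support on \<open>C([t,T], \<real>)\<close> is equivalent to a small ball property: every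
  \<open>A \<in> F t\<close> of positive probability meets \<open>{sup \<bar>X u - X t - x u\<bar> \<le> \<delta>}\<close> in positive probability, for
  every continuous \<open>x\<close> with \<open>x t = 0\<close>. Since \<open>(H, k)\<close> is independent of \<open>X\<close>, Fubini reduces this property
  of \<open>Z\<close> to frozen paths of \<open>H\<close> and \<open>k\<close>, and to events of the natural filtration of \<open>X\<close>. For a frozen \<open>k\<close>
  of finite variation bounded away from zero, \<open>X \<mapsto> \<integral> k dX\<close> is Lipschitz in the uniform norm, and it is
  onto, because \<open>x = \<integral> (1/k) dg\<close> satisfies \<open>\<integral> k dx = g\<close>. So the small balls of \<open>Z\<close> contain images of
  small balls of \<open>X\<close>.\<close>

subsection \<open>Riemann--Stieltjes integrals of functions of finite variation\<close>

text \<open>The obstacle is the filtration: \<open>Z\<close> is conditioned on its own past, which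
  mixes \<open>X\<close>, \<open>H\<close> and \<open>k\<close>, so its conditional law is not
  explicit. The small ball property avoids this law, being tested on one event at a time. An event
  \<open>A\<close> of the past of \<open>Z\<close> up to \<open>t\<close> is the diagonal trace of a
  set in the product of the past of \<open>X\<close> up to \<open>t\<close> with the sigma-algebra
  of the whole paths of \<open>(H, k)\<close>, future included. Once the second coordinate is
  frozen, the slice of this set is an event of the natural filtration of \<open>X\<close> at
  \<open>t\<close>, where the hypothesis on \<open>X\<close> applies. On a slice the past of
  \<open>X\<close> is not controlled, so the integral has to be Lipschitz in the increments after
  \<open>t\<close> alone. Since \<open>k\<close> may jump, the estimates rest on one comparison:
  over {u..v} the integral differs from \<open>f v * (g v - g u)\<close> by at most 3 times the
  oscillation of \<open>g\<close> times the variation of \<open>f\<close>. The way back from small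
  balls to conditional full support needs a conditional law on path space; it is built by coding
  paths as real numbers.\<close>

definition variation_dominated :: "(real \<Rightarrow> real) \<Rightarrow> (real \<Rightarrow> real) \<Rightarrow> real \<Rightarrow> real \<Rightarrow> bool" where
  "variation_dominated f W a b \<longleftrightarrow>
     (\<forall>x y. a \<le> x \<longrightarrow> x \<le> y \<longrightarrow> y \<le> b \<longrightarrow> \<bar>f y - f x\<bar> \<le> W y - W x)"

lemma variation_dominatedD:
  "variation_dominated f W a b \<Longrightarrow> a \<le> x \<Longrightarrow> x \<le> y \<Longrightarrow> y \<le> b \<Longrightarrow> \<bar>f y - f x\<bar> \<le> W y - W x"
  by (simp add: variation_dominated_def)

lemma variation_dominated_mono:
  "variation_dominated f W a b \<Longrightarrow> a \<le> x \<Longrightarrow> x \<le> y \<Longrightarrow> y \<le> b \<Longrightarrow> W x \<le> W y"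
  using variation_dominatedD by fastforce

lemma variation_dominated_subinterval:
  "variation_dominated f W a b \<Longrightarrow> a \<le> u \<Longrightarrow> v \<le> b \<Longrightarrow> variation_dominated f W u v"
  by (simp add: variation_dominated_def)

text \<open>\<open>W x\<close> is the total variation of \<open>f\<close> on {a..x}, a supremum of
  division sums. Appending {x..y} to a division of {a..x} raises the sum by
  \<open>|f y - f x|\<close>, so the supremum grows by at least that much. Only this inequality is
  kept: one \<open>W\<close> then serves every subinterval, and its increments telescope along a
  division.\<close>

lemma finite_variation_on_imp_dominated:
  assumes fv: "finite_variation_on f a b"
  obtains W where "variation_dominated f W a b"
proof -
  let ?s = "\<lambda>d. \<Sum>K\<in>d. \<bar>f (Sup K) - f (Inf K)\<bar>"
  obtain B where B: "\<And>d. d division_of {a..b} \<Longrightarrow> ?s d \<le> B"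
    using fv by (auto simp: finite_variation_on_def)
  have ext: "insert {x..y} d division_of {a..y} \<and> ?s (insert {x..y} d) = ?s d + \<bar>f y - f x\<bar>"
    if d: "d division_of {a..x}" and xy: "a \<le> x" "x < y" for d x y
  proof
    have "{{x..y}} division_of {x..y}"
      using division_of_self[of x y] xy by (simp add: cbox_interval)
    then have "d \<union> {{x..y}} division_of {a..x} \<union> {x..y}"
      by (intro division_disjoint_union d) auto
    then show "insert {x..y} d division_of {a..y}"
      using xy by (simp add: ivl_disj_un_two_touch(4))
    have "{x..y} \<notin> d"
    proof
      assume "{x..y} \<in> d"
      then have "{x..y} \<subseteq> {a..x}" using division_ofD(2)[OF d] by blast
      then show False using xy by auto
    qed
    then show "?s (insert {x..y} d) = ?s d + \<bar>f y - f x\<bar>"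
      using division_ofD(1)[OF d] xy by simp
  qed
  define S where "S x = {?s d | d. d division_of {a..x}}" for x
  have bdd: "bdd_above (S x)" if "a \<le> x" "x \<le> b" for x
  proof (rule bdd_aboveI[of _ B])
    fix s assume "s \<in> S x"
    then obtain d where d: "d division_of {a..x}" "s = ?s d" by (auto simp: S_def)
    show "s \<le> B"
    proof (cases "x = b")
      case True
      with d B show ?thesis by simp
    next
      case False
      with ext[OF d(1), of b] B that d(2) show ?thesis by fastforce
    qed
  qed
  have ne: "S x \<noteq> {}" if "a \<le> x" for x
    using division_of_self[of a x] that by (auto simp: S_def cbox_interval)
  show thesis
  proof
    show "variation_dominated f (\<lambda>x. Sup (S x)) a b"
      unfolding variation_dominated_def
    proof (intro allI impI)
      fix x y assume xy: "a \<le> x" "x \<le> y" "y \<le> b"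
      show "\<bar>f y - f x\<bar> \<le> Sup (S y) - Sup (S x)"
      proof (cases "x = y")
        case False
        with xy have lt: "x < y" by simp
        have "Sup (S x) \<le> Sup (S y) - \<bar>f y - f x\<bar>"
        proof (rule cSup_least)
          show "S x \<noteq> {}" using ne xy by auto
          fix s assume "s \<in> S x"
          then obtain d where d: "d division_of {a..x}" "s = ?s d" by (auto simp: S_def)
          have "s + \<bar>f y - f x\<bar> \<in> S y"
            using ext[OF d(1) xy(1) lt] d(2) unfolding S_def by force
          then have "s + \<bar>f y - f x\<bar> \<le> Sup (S y)"
            using bdd xy by (intro cSup_upper) auto
          then show "s \<le> Sup (S y) - \<bar>f y - f x\<bar>" by simp
        qed
        then show ?thesis by simp
      qed simp
    qed
  qed
qed

text \<open>\<open>J\<close> and \<open>W\<close> both telescope over a division, so local errors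
  \<open>e * (W v - W u)\<close> add up to \<open>e * (W b - W a)\<close>. Moving the tag from the
  right endpoint to an arbitrary point costs \<open>|f v - f x|\<close> times the oscillation of
  \<open>g\<close>, which is again at most \<open>e * (W v - W u)\<close> on short intervals.
  Existence of the integral is thus reduced to finding a \<open>J\<close> with good
  increments.\<close>

lemma has_RS_integral_sewing:
  assumes ab: "a \<le> b" and f: "variation_dominated f W a b" and g: "continuous_on {a..b} g"
    and sew: "\<And>e. e > 0 \<Longrightarrow> \<exists>d>0. \<forall>u v. a \<le> u \<longrightarrow> u \<le> v \<longrightarrow> v \<le> b \<longrightarrow> v - u < d \<longrightarrow>
      \<bar>J v - J u - f v * (g v - g u)\<bar> \<le> e * (W v - W u)"
  shows "has_RS_integral f g a b (J b - J a)"
  unfolding has_RS_integral_def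
proof (intro allI impI)
  fix \<epsilon> :: real assume \<epsilon>: "\<epsilon> > 0"
  \<comment> \<open>The summand 1 keeps the division by \<open>V\<close> legitimate when
    \<open>W b = W a\<close> and makes the final inequality strict.\<close>
  define V where "V = W b - W a + 1"
  have V: "V > 0" "W b - W a < V"
    using variation_dominated_mono[OF f, of a b] ab by (auto simp: V_def)
  define e where "e = \<epsilon> / (2 * V)"
  have e: "e > 0" using \<epsilon> V by (simp add: e_def)
  obtain d where d: "d > 0" "\<And>u v. a \<le> u \<Longrightarrow> u \<le> v \<Longrightarrow> v \<le> b \<Longrightarrow> v - u < d \<Longrightarrow>
      \<bar>J v - J u - f v * (g v - g u)\<bar> \<le> e * (W v - W u)"
    using sew[OF e] by blast
  have "uniformly_continuous_on {a..b} g"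
    using g by (intro compact_uniformly_continuous) auto
  then obtain d' where d': "d' > 0"
    "\<And>u v. u \<in> {a..b} \<Longrightarrow> v \<in> {a..b} \<Longrightarrow> dist v u < d' \<Longrightarrow> dist (g v) (g u) < e"
    unfolding uniformly_continuous_on_def using e by metis
  show "\<exists>\<delta>>0. \<forall>p. p tagged_division_of {a..b} \<and> (\<forall>(x, K)\<in>p. Sup K - Inf K < \<delta>) \<longrightarrow>
      \<bar>(\<Sum>(x, K)\<in>p. f x * (g (Sup K) - g (Inf K))) - (J b - J a)\<bar> < \<epsilon>"
  proof (intro exI[of _ "min d d'"] conjI allI impI)
    show "min d d' > 0" using d(1) d'(1) by simp
  next
    fix p assume p: "p tagged_division_of {a..b} \<and> (\<forall>(x, K)\<in>p. Sup K - Inf K < min d d')"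
    then have fin: "finite p" by auto
    have J: "J b - J a = (\<Sum>(x, K)\<in>p. J (Sup K) - J (Inf K))"
      using additive_tagged_division_1[of a b p J] ab p by auto
    have W: "W b - W a = (\<Sum>(x, K)\<in>p. W (Sup K) - W (Inf K))"
      using additive_tagged_division_1[of a b p W] ab p by auto
    have "\<bar>(\<Sum>(x, K)\<in>p. f x * (g (Sup K) - g (Inf K))) - (J b - J a)\<bar>
        = \<bar>\<Sum>(x, K)\<in>p. f x * (g (Sup K) - g (Inf K)) - (J (Sup K) - J (Inf K))\<bar>"
      by (simp add: J sum_subtractf case_prod_unfold)
    also have "\<dots> \<le> (\<Sum>(x, K)\<in>p. 2 * e * (W (Sup K) - W (Inf K)))"
    proof (rule order_trans[OF sum_abs], rule sum_mono, clarify)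
      fix x K assume xK: "(x, K) \<in> p"
      then obtain u v where K: "K = {u..v}" "x \<in> K"
        using p tagged_division_ofD(2,4) by (metis cbox_interval)
      have "K \<subseteq> {a..b}" using p xK tagged_division_ofD(3) by blast
      with K have uv: "a \<le> u" "u \<le> x" "x \<le> v" "v \<le> b" "u \<le> v" by auto
      have "v - u < min d d'" using p xK K uv by fastforce
      then have lt: "v - u < d" "v - u < d'" by auto
      have "\<bar>g v - g u\<bar> \<le> e"
        using d'(2)[of u v] uv lt by (auto simp: dist_real_def)
      moreover have "\<bar>f v - f x\<bar> \<le> W v - W u"
        using variation_dominatedD[OF f, of x v] variation_dominated_mono[OF f, of u x] uv by auto
      ultimately have "\<bar>f v - f x\<bar> * \<bar>g v - g u\<bar> \<le> (W v - W u) * e"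
        by (intro mult_mono) auto
      then have "\<bar>(f x - f v) * (g v - g u)\<bar> \<le> e * (W v - W u)"
        by (simp add: abs_mult abs_minus_commute mult.commute)
      moreover have "\<bar>J v - J u - f v * (g v - g u)\<bar> \<le> e * (W v - W u)"
        by (rule d(2)) (use uv lt in auto)
      moreover have "f x * (g v - g u) - (J v - J u)
          = (f x - f v) * (g v - g u) - (J v - J u - f v * (g v - g u))"
        by (simp add: algebra_simps)
      ultimately have "\<bar>f x * (g v - g u) - (J v - J u)\<bar> \<le> 2 * e * (W v - W u)"
        by linarith
      then show "\<bar>f x * (g (Sup K) - g (Inf K)) - (J (Sup K) - J (Inf K))\<bar>
          \<le> 2 * e * (W (Sup K) - W (Inf K))"
        using K uv by simp
    qed
    also have "\<dots> = 2 * e * (W b - W a)"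
      by (simp add: W sum_distrib_left case_prod_unfold)
    also have "\<dots> < 2 * e * V" using e V by simp
    also have "\<dots> = \<epsilon>" using V by (simp add: e_def)
    finally show "\<bar>(\<Sum>(x, K)\<in>p. f x * (g (Sup K) - g (Inf K))) - (J b - J a)\<bar> < \<epsilon>" .
  qed
qed

text \<open>Integration by parts with the integral against the monotone integrator written as an
  integral over its range, with the generalised inverse of \<open>f\<close> inside \<open>g\<close>.\<close>

lemma mono_RS_primitive:
  fixes f g :: "real \<Rightarrow> real"
  assumes ab: "a \<le> b" and f: "mono_on {a..b} f" and g: "continuous_on {a..b} g"
  obtains J where "\<And>u v m. a \<le> u \<Longrightarrow> u \<le> v \<Longrightarrow> v \<le> b \<Longrightarrow> (\<And>s. s \<in> {u..v} \<Longrightarrow> \<bar>g s - g u\<bar> \<le> m) \<Longrightarrow>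
      \<bar>J v - J u - f v * (g v - g u)\<bar> \<le> m * (f v - f u)"
proof -
  \<comment> \<open>Generalised inverse of \<open>f\<close>: the infimum of the points where
    \<open>f\<close> is at least \<open>l\<close>. Inserting \<open>b\<close> keeps the set nonempty
    and yields \<open>b\<close> for levels that \<open>f\<close> never reaches.\<close>
  define c where "c l = Inf (insert b {x\<in>{a..b}. l \<le> f x})" for l
  have bddc: "bdd_below (insert b {x\<in>{a..b}. l \<le> f x})" for l
    using ab by (intro bdd_belowI[of _ a]) auto
  have c_in: "c l \<in> {a..b}" for l
    unfolding c_def using ab bddc by (auto intro!: cInf_greatest cInf_lower)
  have "mono c"
  proof (rule monoI)
    fix l l' :: real assume "l \<le> l'"
    then show "c l \<le> c l'"
      unfolding c_def by (intro cInf_superset_mono bddc) auto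
  qed
  define h where "h l = g (c l)" for l
  \<comment> \<open>\<open>g'\<close> extends \<open>g\<close> continuously to the line by clamping
    the argument; it serves to show that \<open>h\<close> is Borel, as its composition with the
    monotone \<open>c\<close>.\<close>
  define g' where "g' x = g (max a (min b x))" for x
  have "continuous_on UNIV g'"
    unfolding g'_def using ab
    by (intro continuous_on_compose2[OF g] continuous_intros) auto
  then have g'_meas: "g' \<in> borel_measurable borel"
    by (rule borel_measurable_continuous_onI)
  have h_eq: "h = (\<lambda>l. g' (c l))"
  proof
    fix l
    have "max a (min b (c l)) = c l" using c_in[of l] by auto
    then show "h l = g' (c l)" by (simp add: h_def g'_def)
  qed
  have h_meas: "h \<in> borel_measurable borel"
    unfolding h_eq using measurable_compose[OF borel_measurable_mono[OF \<open>mono c\<close>] g'_meas] .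
  have "compact (g ` {a..b})" using g by (intro compact_continuous_image) auto
  then have "bounded (g ` {a..b})" by (rule compact_imp_bounded)
  then obtain K where K: "\<And>x. x \<in> {a..b} \<Longrightarrow> \<bar>g x\<bar> \<le> K"
    unfolding bounded_iff by (metis imageI real_norm_def)
  have h_int: "h integrable_on {p..q}" for p q
  proof (rule measurable_bounded_by_integrable_imp_integrable)
    show "h \<in> borel_measurable (lebesgue_on {p..q})"
      using h_meas by (intro measurable_restrict_space1) (simp add: measurable_completion)
    show "(\<lambda>_. K) integrable_on {p..q}" by (rule integrable_const_ivl)
    show "norm (h x) \<le> K" for x using K c_in by (simp add: h_def)
  qed auto
  define A where "A v = integral {f a..f v} h" for v
  show thesis
  proof
    fix u v m assume uv: "a \<le> u" "u \<le> v" "v \<le> b"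
      and m: "\<And>s. s \<in> {u..v} \<Longrightarrow> \<bar>g s - g u\<bar> \<le> m"
    have fle: "f a \<le> f u" "f u \<le> f v"
      using mono_onD[OF f] uv by auto
    have "A v = A u + integral {f u..f v} h"
      unfolding A_def using Henstock_Kurzweil_Integration.integral_combine[OF fle h_int] by simp
    \<comment> \<open>For levels above \<open>f u\<close> and up to \<open>f v\<close>, the inverse
      \<open>c l\<close> lies in {u..v}, where \<open>g\<close> is within \<open>m\<close> of
      \<open>g u\<close>. At the level \<open>f u\<close> itself it may lie to the left of
      \<open>u\<close>, hence the exceptional point.\<close>
    moreover have "norm (integral (cbox (f u) (f v)) (\<lambda>l. h l - g u)) \<le> m * measure lborel (cbox (f u) (f v))"
    proof (rule has_integral_bound_spike_finite[where f="\<lambda>l. h l - g u" and S="{f u}"])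
      show "0 \<le> m" using m[of u] uv by simp
      show "((\<lambda>l. h l - g u) has_integral integral (cbox (f u) (f v)) (\<lambda>l. h l - g u)) (cbox (f u) (f v))"
        using h_int by (intro integrable_integral integrable_diff) (auto simp: cbox_interval)
      fix l assume "l \<in> cbox (f u) (f v) - {f u}"
      then have l: "f u < l" "l \<le> f v" by auto
      have "c l \<le> v" unfolding c_def using l uv by (intro cInf_lower bddc) auto
      moreover have "u \<le> c l" unfolding c_def
      proof (rule cInf_greatest)
        fix x assume x: "x \<in> insert b {x \<in> {a..b}. l \<le> f x}"
        show "u \<le> x"
        proof (rule ccontr)
          assume "\<not> u \<le> x"
          moreover from this have "x \<noteq> b" using uv by auto
          ultimately have "f x \<le> f u" using x uv by (intro mono_onD[OF f]) auto
          with x \<open>x \<noteq> b\<close> l show False by auto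
        qed
      qed simp
      ultimately show "norm (h l - g u) \<le> m" using m by (simp add: h_def)
    qed auto
    moreover have "integral {f u..f v} (\<lambda>l. h l - g u) = integral {f u..f v} h - g u * (f v - f u)"
      using h_int fle by (subst Henstock_Kurzweil_Integration.integral_diff) auto
    ultimately have "\<bar>A v - A u - g u * (f v - f u)\<bar> \<le> m * (f v - f u)"
      using fle by (simp add: cbox_interval)
    \<comment> \<open>With \<open>J v = f v * g v - A v\<close>, the boundary terms leave
      \<open>g u * (f v - f u)\<close>, so the defect of \<open>J\<close> is minus the integral of
      \<open>h - g u\<close> over the range.\<close>
    moreover have "(f v * g v - A v) - (f u * g u - A u) - f v * (g v - g u)
        = - (A v - A u - g u * (f v - f u))"
      by (simp add: algebra_simps)
    ultimately show "\<bar>(f v * g v - A v) - (f u * g u - A u) - f v * (g v - g u)\<bar> \<le> m * (f v - f u)"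
      by (metis abs_minus_cancel)
  qed
qed

text \<open>\<open>f = W - (W - f)\<close> is a difference of two nondecreasing functions. The part
  \<open>W\<close> has error at most \<open>m * (W v - W u)\<close>; the increment of
  \<open>W - f\<close> is at most twice that of \<open>W\<close>, which accounts for the rest of the
  constant 3.\<close>

lemma RS_primitive:
  assumes ab: "a \<le> b" and f: "variation_dominated f W a b" and g: "continuous_on {a..b} g"
  obtains J where "\<And>u v m. a \<le> u \<Longrightarrow> u \<le> v \<Longrightarrow> v \<le> b \<Longrightarrow> (\<And>s. s \<in> {u..v} \<Longrightarrow> \<bar>g s - g u\<bar> \<le> m) \<Longrightarrow>
      \<bar>J v - J u - f v * (g v - g u)\<bar> \<le> 3 * m * (W v - W u)"
proof -
  have W: "mono_on {a..b} W"
    using variation_dominated_mono[OF f] by (auto intro!: mono_onI)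
  have Wf: "mono_on {a..b} (\<lambda>x. W x - f x)"
    using variation_dominatedD[OF f] by (intro mono_onI) (force simp: abs_le_iff)
  obtain J1 where J1: "\<And>u v m. a \<le> u \<Longrightarrow> u \<le> v \<Longrightarrow> v \<le> b \<Longrightarrow> (\<And>s. s \<in> {u..v} \<Longrightarrow> \<bar>g s - g u\<bar> \<le> m) \<Longrightarrow>
      \<bar>J1 v - J1 u - W v * (g v - g u)\<bar> \<le> m * (W v - W u)"
    using mono_RS_primitive[OF ab W g] by blast
  obtain J2 where J2: "\<And>u v m. a \<le> u \<Longrightarrow> u \<le> v \<Longrightarrow> v \<le> b \<Longrightarrow> (\<And>s. s \<in> {u..v} \<Longrightarrow> \<bar>g s - g u\<bar> \<le> m) \<Longrightarrow>
      \<bar>J2 v - J2 u - (W v - f v) * (g v - g u)\<bar> \<le> m * ((W v - f v) - (W u - f u))"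
    using mono_RS_primitive[OF ab Wf g] by blast
  show thesis
  proof
    fix u v m assume uv: "a \<le> u" "u \<le> v" "v \<le> b"
      and m: "\<And>s. s \<in> {u..v} \<Longrightarrow> \<bar>g s - g u\<bar> \<le> m"
    have m0: "m \<ge> 0" using m[of u] uv by simp
    have "m * ((W v - f v) - (W u - f u)) \<le> m * (2 * (W v - W u))"
      using variation_dominatedD[OF f uv] m0 by (intro mult_left_mono) auto
    moreover have "(J1 v - J2 v) - (J1 u - J2 u) - f v * (g v - g u)
        = (J1 v - J1 u - W v * (g v - g u)) - (J2 v - J2 u - (W v - f v) * (g v - g u))"
      by (simp add: algebra_simps)
    ultimately show "\<bar>(J1 v - J2 v) - (J1 u - J2 u) - f v * (g v - g u)\<bar> \<le> 3 * m * (W v - W u)"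
      using J1[OF uv m] J2[OF uv m] by (simp add: abs_le_iff algebra_simps)
  qed
qed

lemma continuous_on_osc:
  fixes g :: "real \<Rightarrow> real"
  assumes "continuous_on {a..b} g" "e > 0"
  obtains d where "d > 0"
    "\<And>u v s. a \<le> u \<Longrightarrow> v \<le> b \<Longrightarrow> v - u < d \<Longrightarrow> s \<in> {u..v} \<Longrightarrow> \<bar>g s - g u\<bar> \<le> e"
proof -
  have "uniformly_continuous_on {a..b} g"
    using assms by (intro compact_uniformly_continuous) auto
  then obtain d where d: "d > 0"
    "\<And>u v. u \<in> {a..b} \<Longrightarrow> v \<in> {a..b} \<Longrightarrow> dist v u < d \<Longrightarrow> dist (g v) (g u) < e"
    unfolding uniformly_continuous_on_def using assms(2) by metis
  show thesis
  proof (rule that[OF d(1)])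
    fix u v s assume "a \<le> u" "v \<le> b" "v - u < d" "s \<in> {u..v}"
    then show "\<bar>g s - g u\<bar> \<le> e"
      using d(2)[of u s] by (auto simp: dist_real_def)
  qed
qed

lemma RS_integral_eqI: "has_RS_integral f g a b L \<Longrightarrow> RS_integral f g a b = L"
  unfolding RS_integral_def by (blast intro: the_equality has_RS_integral_unique)

text \<open>The function from \<open>RS_primitive\<close> meets the sewing condition, so up to its
  value at \<open>a\<close> it is the integral, and its increment estimate becomes one for the
  integral itself. The comparison with the right-endpoint term needs no continuity of
  \<open>f\<close>; the Lipschitz bound, the continuity in the upper limit and the inversion all
  start from it.\<close>

lemma
  assumes f: "variation_dominated f W a b" and g: "continuous_on {a..b} g"
  shows has_RS_integral_RS_integral:
      "a \<le> t \<Longrightarrow> t \<le> b \<Longrightarrow> has_RS_integral f g a t (RS_integral f g a t)"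
    and RS_integral_increment:
      "a \<le> u \<Longrightarrow> u \<le> v \<Longrightarrow> v \<le> b \<Longrightarrow> (\<And>s. s \<in> {u..v} \<Longrightarrow> \<bar>g s - g u\<bar> \<le> m) \<Longrightarrow>
        \<bar>RS_integral f g a v - RS_integral f g a u - f v * (g v - g u)\<bar> \<le> 3 * m * (W v - W u)"
proof -
  have "(\<forall>t. a \<le> t \<longrightarrow> t \<le> b \<longrightarrow> has_RS_integral f g a t (RS_integral f g a t)) \<and>
    (\<forall>u v m. a \<le> u \<longrightarrow> u \<le> v \<longrightarrow> v \<le> b \<longrightarrow> (\<forall>s\<in>{u..v}. \<bar>g s - g u\<bar> \<le> m) \<longrightarrow>
      \<bar>RS_integral f g a v - RS_integral f g a u - f v * (g v - g u)\<bar> \<le> 3 * m * (W v - W u))"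
  proof (cases "a \<le> b")
    case ab: True
    obtain J where J: "\<And>u v m. a \<le> u \<Longrightarrow> u \<le> v \<Longrightarrow> v \<le> b \<Longrightarrow> (\<And>s. s \<in> {u..v} \<Longrightarrow> \<bar>g s - g u\<bar> \<le> m) \<Longrightarrow>
        \<bar>J v - J u - f v * (g v - g u)\<bar> \<le> 3 * m * (W v - W u)"
      using RS_primitive[OF ab f g] by blast
    have has: "has_RS_integral f g a t (J t - J a)" if t: "a \<le> t" "t \<le> b" for t
    proof (rule has_RS_integral_sewing[OF t(1)])
      show "variation_dominated f W a t"
        using t by (intro variation_dominated_subinterval[OF f]) auto
      show "continuous_on {a..t} g"
        using t by (intro continuous_on_subset[OF g]) auto
      fix e :: real assume "e > 0"
      then have e: "e / 3 > 0" by simp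
      obtain d where d: "d > 0"
        "\<And>u v s. a \<le> u \<Longrightarrow> v \<le> b \<Longrightarrow> v - u < d \<Longrightarrow> s \<in> {u..v} \<Longrightarrow> \<bar>g s - g u\<bar> \<le> e / 3"
        using continuous_on_osc[OF g e] by blast
      show "\<exists>d>0. \<forall>u v. a \<le> u \<longrightarrow> u \<le> v \<longrightarrow> v \<le> t \<longrightarrow> v - u < d \<longrightarrow>
          \<bar>J v - J u - f v * (g v - g u)\<bar> \<le> e * (W v - W u)"
      proof (intro exI[of _ d] conjI allI impI d(1))
        fix u v assume uv: "a \<le> u" "u \<le> v" "v \<le> t" "v - u < d"
        have "\<bar>J v - J u - f v * (g v - g u)\<bar> \<le> 3 * (e / 3) * (W v - W u)"
          using uv t d(2)[of u v] by (intro J) auto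
        then show "\<bar>J v - J u - f v * (g v - g u)\<bar> \<le> e * (W v - W u)" by simp
      qed
    qed
    then have "RS_integral f g a t = J t - J a" if "a \<le> t" "t \<le> b" for t
      using that by (intro RS_integral_eqI)
    with has J show ?thesis by simp
  qed auto
  then show "a \<le> t \<Longrightarrow> t \<le> b \<Longrightarrow> has_RS_integral f g a t (RS_integral f g a t)"
    and "a \<le> u \<Longrightarrow> u \<le> v \<Longrightarrow> v \<le> b \<Longrightarrow> (\<And>s. s \<in> {u..v} \<Longrightarrow> \<bar>g s - g u\<bar> \<le> m) \<Longrightarrow>
        \<bar>RS_integral f g a v - RS_integral f g a u - f v * (g v - g u)\<bar> \<le> 3 * m * (W v - W u)"
    by blast+
qed

section \<open>Linearity, Lipschitz dependence and inversion of the integral\<close>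

lemma RS_integral_diff:
  assumes "variation_dominated f W a b" "a \<le> b" "continuous_on {a..b} g" "continuous_on {a..b} h"
  shows "RS_integral f (\<lambda>s. g s - h s) a b = RS_integral f g a b - RS_integral f h a b"
proof (rule RS_integral_eqI, unfold has_RS_integral_def, intro allI impI)
  fix e :: real assume e: "e > 0"
  let ?S = "\<lambda>g p. \<Sum>(x, K)\<in>p. f x * (g (Sup K) - g (Inf K))"
  obtain d where d: "d > 0" "\<And>p. p tagged_division_of {a..b} \<Longrightarrow>
      (\<forall>(x, K)\<in>p. Sup K - Inf K < d) \<Longrightarrow> \<bar>?S g p - RS_integral f g a b\<bar> < e / 2"
    using has_RS_integral_RS_integral[OF assms(1,3,2) order_refl] e
    unfolding has_RS_integral_def by (meson half_gt_zero)
  obtain d' where d': "d' > 0" "\<And>p. p tagged_division_of {a..b} \<Longrightarrow>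
      (\<forall>(x, K)\<in>p. Sup K - Inf K < d') \<Longrightarrow> \<bar>?S h p - RS_integral f h a b\<bar> < e / 2"
    using has_RS_integral_RS_integral[OF assms(1,4,2) order_refl] e
    unfolding has_RS_integral_def by (meson half_gt_zero)
  show "\<exists>\<delta>>0. \<forall>p. p tagged_division_of {a..b} \<and> (\<forall>(x, K)\<in>p. Sup K - Inf K < \<delta>) \<longrightarrow>
      \<bar>?S (\<lambda>s. g s - h s) p - (RS_integral f g a b - RS_integral f h a b)\<bar> < e"
  proof (intro exI[of _ "min d d'"] conjI allI impI)
    show "min d d' > 0" using d(1) d'(1) by simp
    fix p assume p: "p tagged_division_of {a..b} \<and> (\<forall>(x, K)\<in>p. Sup K - Inf K < min d d')"
    have "?S (\<lambda>s. g s - h s) p = ?S g p - ?S h p"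
      by (simp add: sum_subtractf[symmetric] case_prod_unfold algebra_simps)
    moreover have "\<bar>?S g p - RS_integral f g a b\<bar> < e / 2"
      by (rule d(2)) (use p in auto)
    moreover have "\<bar>?S h p - RS_integral f h a b\<bar> < e / 2"
      by (rule d'(2)) (use p in auto)
    ultimately show "\<bar>?S (\<lambda>s. g s - h s) p - (RS_integral f g a b - RS_integral f h a b)\<bar> < e"
      by linarith
  qed
qed

lemma RS_integral_refl [simp]: "RS_integral f g a a = 0"
proof -
  have eq: "x = y" if "a \<le> x" "x \<le> y" "y \<le> a" for x y :: real
    using that by simp
  have "has_RS_integral f g a a ((\<lambda>_. 0) a - (\<lambda>_. 0) a)"
    by (rule has_RS_integral_sewing[where W="\<lambda>_. 0"])
      (auto simp: variation_dominated_def intro!: exI[of _ 1] dest: eq)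
  then show ?thesis by (simp add: RS_integral_eqI)
qed

lemma variation_dominated_bounded:
  assumes "variation_dominated f W a b" "u \<in> {a..b}"
  shows "\<bar>f u\<bar> \<le> \<bar>f a\<bar> + (W b - W a)"
  using variation_dominatedD[OF assms(1), of a u] variation_dominated_mono[OF assms(1), of u b]
    assms(2) by auto

text \<open>By linearity only \<open>D = g - h\<close> matters. Its integral over {t..u} is within
  \<open>3 * m * (W b - W a)\<close> of \<open>f u * (D u - D t)\<close>, and \<open>|f u|\<close>
  is at most \<open>|f a| + (W b - W a)\<close>; together these give the factor 4. Only increments
  after \<open>t\<close> are compared, so before \<open>t\<close> the two integrators may be far
  apart.\<close>

lemma RS_integral_Lipschitz:
  assumes f: "variation_dominated f W a b"
    and g: "continuous_on {a..b} g" and h: "continuous_on {a..b} h"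
    and t: "a \<le> t" "t \<le> u" "u \<le> b"
    and m: "\<And>s. s \<in> {t..b} \<Longrightarrow> \<bar>(g s - g t) - (h s - h t)\<bar> \<le> m"
  shows "\<bar>(RS_integral f g a u - RS_integral f g a t) - (RS_integral f h a u - RS_integral f h a t)\<bar>
    \<le> (\<bar>f a\<bar> + 4 * (W b - W a)) * m"
proof -
  let ?D = "\<lambda>s. g s - h s"
  let ?I = "RS_integral f ?D a"
  have D: "continuous_on {a..b} ?D" using g h by (intro continuous_intros)
  have I: "?I v = RS_integral f g a v - RS_integral f h a v" if "a \<le> v" "v \<le> b" for v
    using that by (intro RS_integral_diff[OF variation_dominated_subinterval[OF f]]
        continuous_on_subset[OF g] continuous_on_subset[OF h]) auto
  have m0: "m \<ge> 0" using m[of t] t by simp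
  have "\<bar>?I u - ?I t - f u * (?D u - ?D t)\<bar> \<le> 3 * m * (W u - W t)"
  proof (rule RS_integral_increment[OF f D])
    show "\<bar>?D s - ?D t\<bar> \<le> m" if "s \<in> {t..u}" for s
      using m[of s] that t by (simp add: algebra_simps)
  qed (use t in auto)
  moreover have "\<bar>f u * (?D u - ?D t)\<bar> \<le> (\<bar>f a\<bar> + (W b - W a)) * m"
    unfolding abs_mult using variation_dominated_bounded[OF f, of u] t m[of u]
    by (intro mult_mono) (auto simp: algebra_simps)
  moreover have "3 * m * (W u - W t) \<le> 3 * m * (W b - W a)"
    using variation_dominated_mono[OF f, of a t] variation_dominated_mono[OF f, of u b] t m0
    by (intro mult_left_mono) auto
  ultimately have "\<bar>?I u - ?I t\<bar> \<le> (\<bar>f a\<bar> + 4 * (W b - W a)) * m"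
    by (simp add: algebra_simps)
  then show ?thesis using I t by (simp add: algebra_simps)
qed

lemma continuous_on_RS_integral:
  assumes f: "variation_dominated f W a b" and g: "continuous_on {a..b} g"
  shows "continuous_on {a..b} (RS_integral f g a)"
proof (cases "a \<le> b")
  case ab: True
  \<comment> \<open>The extra 1 makes \<open>C\<close> positive and leaves the margin
    \<open>m\<close> that yields a strict inequality at the end.\<close>
  define C where "C = \<bar>f a\<bar> + 4 * (W b - W a) + 1"
  have C: "C > 0" using variation_dominated_mono[OF f, of a b] ab by (simp add: C_def)
  have inc: "\<exists>d>0. \<forall>u v. a \<le> u \<longrightarrow> u \<le> v \<longrightarrow> v \<le> b \<longrightarrow> v - u < d \<longrightarrow>
      \<bar>RS_integral f g a v - RS_integral f g a u\<bar> < e" if e: "e > 0" for e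
  proof -
    define m where "m = e / (2 * C)"
    have m: "m > 0" "C * m < e" using e C by (auto simp: m_def)
    obtain d where d: "d > 0"
      "\<And>u v s. a \<le> u \<Longrightarrow> v \<le> b \<Longrightarrow> v - u < d \<Longrightarrow> s \<in> {u..v} \<Longrightarrow> \<bar>g s - g u\<bar> \<le> m"
      using continuous_on_osc[OF g m(1)] by blast
    show ?thesis
    proof (intro exI[of _ d] conjI allI impI d(1))
      fix u v assume uv: "a \<le> u" "u \<le> v" "v \<le> b" "v - u < d"
      have "\<bar>RS_integral f g a v - RS_integral f g a u - f v * (g v - g u)\<bar> \<le> 3 * m * (W v - W u)"
        using uv d(2)[of u v] by (intro RS_integral_increment[OF f g]) auto
      moreover have "\<bar>f v * (g v - g u)\<bar> \<le> (\<bar>f a\<bar> + (W b - W a)) * m"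
        unfolding abs_mult using variation_dominated_bounded[OF f, of v] uv d(2)[of u v v]
        by (intro mult_mono) auto
      moreover have "3 * m * (W v - W u) \<le> 3 * m * (W b - W a)"
        using variation_dominated_mono[OF f, of a u] variation_dominated_mono[OF f, of v b] uv m
        by (intro mult_left_mono) auto
      ultimately have "\<bar>RS_integral f g a v - RS_integral f g a u\<bar> \<le> C * m - m"
        by (simp add: C_def algebra_simps)
      then show "\<bar>RS_integral f g a v - RS_integral f g a u\<bar> < e" using m by linarith
    qed
  qed
  show ?thesis
    unfolding continuous_on_iff
  proof (intro ballI allI impI)
    fix x e :: real assume x: "x \<in> {a..b}" and e: "0 < e"
    obtain d where d: "d > 0" "\<And>u v. a \<le> u \<Longrightarrow> u \<le> v \<Longrightarrow> v \<le> b \<Longrightarrow> v - u < d \<Longrightarrow>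
      \<bar>RS_integral f g a v - RS_integral f g a u\<bar> < e"
      using inc[OF e] by blast
    show "\<exists>d>0. \<forall>x'\<in>{a..b}. dist x' x < d \<longrightarrow>
        dist (RS_integral f g a x') (RS_integral f g a x) < e"
    proof (intro exI[of _ d] conjI ballI impI d(1))
      fix y assume y: "y \<in> {a..b}" "dist y x < d"
      show "dist (RS_integral f g a y) (RS_integral f g a x) < e"
        using d(2)[of x y] d(2)[of y x] x y by (cases "x \<le> y") (auto simp: dist_real_def)
    qed
  qed
qed simp

text \<open>As \<open>f\<close> stays away from zero, the variation of \<open>1 / f\<close> is
  dominated by that of \<open>f\<close> divided by the square of \<open>c\<close>, so the inverse
  integral exists. Multiplying the right-endpoint estimate for its increment by \<open>f v\<close>
  cancels the factor \<open>1 / f v\<close> exactly, even where \<open>f\<close> jumps, and what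
  remains is the sewing condition with \<open>J = g\<close>.\<close>

lemma RS_integral_surj:
  assumes ab: "a \<le> b" and f: "variation_dominated f W a b" and g: "continuous_on {a..b} g"
    and c: "c > 0" "\<And>s. s \<in> {a..b} \<Longrightarrow> c \<le> \<bar>f s\<bar>"
  obtains x where "continuous_on {a..b} x"
    "\<And>t. t \<in> {a..b} \<Longrightarrow> RS_integral f x a t = g t - g a"
proof -
  let ?r = "\<lambda>s. 1 / f s" and ?R = "\<lambda>s. W s / (c * c)"
  have r: "variation_dominated ?r ?R a b"
    unfolding variation_dominated_def
  proof (intro allI impI)
    fix x y assume xy: "a \<le> x" "x \<le> y" "y \<le> b"
    have cc: "c \<le> \<bar>f x\<bar>" "c \<le> \<bar>f y\<bar>" using c xy by auto
    then have nz: "f x \<noteq> 0" "f y \<noteq> 0" using c(1) by auto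
    have "?r y - ?r x = (f x - f y) / (f x * f y)"
      using nz by (simp add: field_simps)
    then have "\<bar>?r y - ?r x\<bar> = \<bar>f y - f x\<bar> / (\<bar>f x\<bar> * \<bar>f y\<bar>)"
      by (simp add: abs_mult abs_divide abs_minus_commute)
    also have "\<dots> \<le> (W y - W x) / (c * c)"
      using variation_dominatedD[OF f xy] cc c(1) by (intro frac_le mult_mono) auto
    finally show "\<bar>?r y - ?r x\<bar> \<le> ?R y - ?R x" by (simp add: diff_divide_distrib)
  qed
  define x where "x = RS_integral ?r g a"
  have x: "continuous_on {a..b} x"
    unfolding x_def by (rule continuous_on_RS_integral[OF r g])
  define K where "K = \<bar>f a\<bar> + (W b - W a) + 1"
  have K: "K > 0" "\<And>s. s \<in> {a..b} \<Longrightarrow> \<bar>f s\<bar> \<le> K"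
    using variation_dominated_bounded[OF f] variation_dominated_mono[OF f, of a b] ab
    by (fastforce simp: K_def)+
  have "RS_integral f x a t = g t - g a" if t: "t \<in> {a..b}" for t
  proof (rule RS_integral_eqI, rule has_RS_integral_sewing)
    show "a \<le> t" using t by simp
    show "variation_dominated f W a t"
      using t by (intro variation_dominated_subinterval[OF f]) auto
    show "continuous_on {a..t} x"
      using t by (intro continuous_on_subset[OF x]) auto
    fix e :: real assume e: "e > 0"
    \<comment> \<open>\<open>K\<close> bounds \<open>|f|\<close> and the variation of
      \<open>1 / f\<close> carries the inverse square of \<open>c\<close>; with this
      \<open>m\<close> their product with the constant 3 becomes \<open>e\<close>.\<close>
    define m where "m = e * (c * c) / (3 * K)"
    have m: "m > 0" "K * (3 * m) = e * (c * c)" using e c K by (auto simp: m_def)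
    obtain d where d: "d > 0"
      "\<And>u v s. a \<le> u \<Longrightarrow> v \<le> b \<Longrightarrow> v - u < d \<Longrightarrow> s \<in> {u..v} \<Longrightarrow> \<bar>g s - g u\<bar> \<le> m"
      using continuous_on_osc[OF g m(1)] by blast
    show "\<exists>d>0. \<forall>u v. a \<le> u \<longrightarrow> u \<le> v \<longrightarrow> v \<le> t \<longrightarrow> v - u < d \<longrightarrow>
        \<bar>g v - g u - f v * (x v - x u)\<bar> \<le> e * (W v - W u)"
    proof (intro exI[of _ d] conjI allI impI d(1))
      fix u v assume uv: "a \<le> u" "u \<le> v" "v \<le> t" "v - u < d"
      then have v: "v \<in> {a..b}" using t by auto
      have "\<bar>x v - x u - ?r v * (g v - g u)\<bar> \<le> 3 * m * (?R v - ?R u)"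
        unfolding x_def using uv v d(2)[of u v] by (intro RS_integral_increment[OF r g]) auto
      then have "\<bar>f v\<bar> * \<bar>x v - x u - ?r v * (g v - g u)\<bar> \<le> K * (3 * m * (?R v - ?R u))"
        using K v by (intro mult_mono) auto
      also have "\<dots> = K * (3 * m) * (W v - W u) / (c * c)"
        by (simp add: diff_divide_distrib algebra_simps)
      also have "\<dots> = e * (W v - W u)"
        using c unfolding m(2) by simp
      also have "\<bar>f v\<bar> * \<bar>x v - x u - ?r v * (g v - g u)\<bar> = \<bar>g v - g u - f v * (x v - x u)\<bar>"
      proof -
        have "f v \<noteq> 0" using c(2)[OF v] c(1) by auto
        then have "f v * (x v - x u - ?r v * (g v - g u)) = - (g v - g u - f v * (x v - x u))"
          by (simp add: right_diff_distrib)
        then show ?thesis by (metis abs_minus_cancel abs_mult)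
      qed
      finally show "\<bar>g v - g u - f v * (x v - x u)\<bar> \<le> e * (W v - W u)" .
    qed
  qed
  with x show thesis by (rule that)
qed

text \<open>These sums are finite combinations of values of \<open>f\<close> and \<open>g\<close> at
  times that do not depend on the paths. They exhibit the integral as a limit of measurable
  functions, which gives its joint measurability later.\<close>

lemma RS_sums_tendsto:
  assumes f: "variation_dominated f W 0 b" and g: "continuous_on {0..b} g" and b: "0 \<le> b"
  shows "(\<lambda>n. \<Sum>i<n. f (b * (Suc i / n)) * (g (b * (Suc i / n)) - g (b * (i / n))))
    \<longlonglongrightarrow> RS_integral f g 0 b"
proof (rule LIMSEQ_I)
  fix r :: real assume r: "r > 0"
  define V where "V = W b - W 0 + 1"
  have V: "V > 0" using variation_dominated_mono[OF f, of 0 b] b by (simp add: V_def)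
  define m where "m = r / (3 * V)"
  have m: "m > 0" "3 * m * V = r" using r V by (auto simp: m_def)
  obtain d where d: "d > 0"
    "\<And>u v s. 0 \<le> u \<Longrightarrow> v \<le> b \<Longrightarrow> v - u < d \<Longrightarrow> s \<in> {u..v} \<Longrightarrow> \<bar>g s - g u\<bar> \<le> m"
    using continuous_on_osc[OF g m(1)] by blast
  obtain N :: nat where N: "b / d < N" using reals_Archimedean2 by blast
  let ?J = "RS_integral f g 0"
  show "\<exists>no. \<forall>n\<ge>no. norm ((\<Sum>i<n. f (b * (Suc i / n)) * (g (b * (Suc i / n)) - g (b * (i / n))))
      - RS_integral f g 0 b) < r"
  \<comment> \<open>\<open>Suc N\<close> rather than \<open>N\<close> excludes \<open>n = 0\<close>,
    for which the partition points need not reach \<open>b\<close>.\<close>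
  proof (intro exI[of _ "Suc N"] allI impI)
    fix n assume n: "Suc N \<le> n"
    let ?t = "\<lambda>i. b * (real i / real n)"
    have tel: "(\<Sum>i<n. F (?t (Suc i)) - F (?t i)) = F b - F 0" for F :: "real \<Rightarrow> real"
      using sum_lessThan_telescope[of "\<lambda>i. F (?t i)" n] n by simp
    have "b / d < n" using N n by linarith
    then have mesh: "b / n < d" using d(1) n by (simp add: field_simps)
    have "\<bar>?J b - (\<Sum>i<n. f (?t (Suc i)) * (g (?t (Suc i)) - g (?t i)))\<bar>
        = \<bar>\<Sum>i<n. ?J (?t (Suc i)) - ?J (?t i) - f (?t (Suc i)) * (g (?t (Suc i)) - g (?t i))\<bar>"
      using tel[of ?J] by (simp add: sum_subtractf)
    also have "\<dots> \<le> (\<Sum>i<n. 3 * m * (W (?t (Suc i)) - W (?t i)))"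
    proof (rule order_trans[OF sum_abs], rule sum_mono)
      fix i assume i: "i \<in> {..<n}"
      have le: "?t i \<le> ?t (Suc i)" "?t (Suc i) \<le> b" "0 \<le> ?t i"
        using b i by (auto intro!: mult_left_mono mult_left_le divide_right_mono simp del: times_divide_eq_right)
      have "?t (Suc i) - ?t i = b / n" by (simp add: add_divide_distrib distrib_left)
      with mesh have "?t (Suc i) - ?t i < d" by simp
      with le show "\<bar>?J (?t (Suc i)) - ?J (?t i) - f (?t (Suc i)) * (g (?t (Suc i)) - g (?t i))\<bar>
          \<le> 3 * m * (W (?t (Suc i)) - W (?t i))"
        by (intro RS_integral_increment[OF f g] d(2)) auto
    qed
    also have "\<dots> = 3 * m * (W b - W 0)"
      unfolding sum_distrib_left[symmetric] tel[of W] ..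
    also have "\<dots> < 3 * m * V" using m(1) by (simp add: V_def)
    finally show "norm ((\<Sum>i<n. f (?t (Suc i)) * (g (?t (Suc i)) - g (?t i))) - ?J b) < r"
      using m(2) by (simp add: abs_minus_commute)
  qed
qed

subsection \<open>Regular conditional laws\<close>

lemma (in prob_space) subalgebra_imp_finite_measure_subalgebra:
  "subalgebra M G \<Longrightarrow> finite_measure_subalgebra M G"
  by (simp add: finite_measure_subalgebra_def finite_measure_subalgebra_axioms_def
      finite_measure_axioms)

text \<open>A conditional expectation is determined almost everywhere by its integrals over the sets
  of \<open>G\<close>. In the integrated form positivity and null events can be read off without
  handling versions, and both sides are measures in \<open>B\<close>, which permits generator
  arguments.\<close>

lemma (in prob_space) cond_law_iff:
  assumes G: "subalgebra M G" and Y: "Y \<in> M \<rightarrow>\<^sub>M N" and \<kappa>: "\<kappa> \<in> G \<rightarrow>\<^sub>M prob_algebra N"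
    and B: "B \<in> sets N"
  shows "(AE \<omega> in M. measure (\<kappa> \<omega>) B = real_cond_exp M G (\<lambda>\<omega>'. indicator B (Y \<omega>')) \<omega>) \<longleftrightarrow>
    (\<forall>A\<in>sets G. (\<integral>\<^sup>+\<omega>. emeasure (\<kappa> \<omega>) B * indicator A \<omega> \<partial>M) = emeasure M (A \<inter> (Y -` B \<inter> space M)))"
proof -
  interpret G: finite_measure_subalgebra M G
    by (rule subalgebra_imp_finite_measure_subalgebra[OF G])
  have \<kappa>_prob: "prob_space (\<kappa> \<omega>)" if "\<omega> \<in> space M" for \<omega>
    using measurable_space[OF \<kappa>, of \<omega>] that G by (simp add: subalgebra_def space_prob_algebra)
  have p_meas: "(\<lambda>\<omega>. measure (\<kappa> \<omega>) B) \<in> borel_measurable G"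
    using measurable_compose[OF \<kappa> measurable_measure_prob_algebra[OF B]] .
  then have p_measM: "(\<lambda>\<omega>. measure (\<kappa> \<omega>) B) \<in> borel_measurable M"
    by (rule measurable_from_subalg[OF G])
  have p_int: "integrable M (\<lambda>\<omega>. measure (\<kappa> \<omega>) B)"
    by (rule integrable_const_bound[of _ 1])
      (use \<kappa>_prob p_measM in \<open>auto intro: prob_space.prob_le_1\<close>)
  define f where "f = (\<lambda>\<omega>. indicator B (Y \<omega>) :: real)"
  have [measurable]: "f \<in> borel_measurable M"
    unfolding f_def by (rule measurable_compose[OF Y borel_measurable_indicator[OF B]])
  have f_bounds: "0 \<le> f \<omega>" "f \<omega> \<le> 1" for \<omega> by (simp_all add: f_def indicator_def)
  have f_int: "integrable M f"
    by (rule integrable_const_bound[of _ 1]) (use f_bounds in auto)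
  have GM: "A \<in> sets M" if "A \<in> sets G" for A using that G by (auto simp: subalgebra_def)
  have lhs: "(\<integral>\<^sup>+\<omega>. emeasure (\<kappa> \<omega>) B * indicator A \<omega> \<partial>M) = ennreal (\<integral>\<omega>\<in>A. measure (\<kappa> \<omega>) B \<partial>M)"
    if A: "A \<in> sets G" for A
  proof -
    have "(\<integral>\<^sup>+\<omega>. emeasure (\<kappa> \<omega>) B * indicator A \<omega> \<partial>M)
        = (\<integral>\<^sup>+\<omega>. ennreal (indicator A \<omega> * measure (\<kappa> \<omega>) B) \<partial>M)"
    proof (rule nn_integral_cong)
      fix \<omega> assume \<omega>: "\<omega> \<in> space M"
      interpret K: prob_space "\<kappa> \<omega>" by (rule \<kappa>_prob[OF \<omega>])
      show "emeasure (\<kappa> \<omega>) B * indicator A \<omega> = ennreal (indicator A \<omega> * measure (\<kappa> \<omega>) B)"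
        by (simp add: K.emeasure_eq_measure indicator_def)
    qed
    also have "\<dots> = ennreal (\<integral>\<omega>\<in>A. measure (\<kappa> \<omega>) B \<partial>M)"
      unfolding set_lebesgue_integral_def using GM[OF A] p_int
      by (subst nn_integral_eq_integral) (auto intro: integrable_mult_indicator[where 'b=real, simplified])
    finally show ?thesis .
  qed
  have rhs: "emeasure M (A \<inter> (Y -` B \<inter> space M)) = ennreal (\<integral>\<omega>\<in>A. f \<omega> \<partial>M)"
    if A: "A \<in> sets G" for A
  proof -
    have "(\<integral>\<omega>\<in>A. f \<omega> \<partial>M) = (\<integral>\<omega>. indicator (A \<inter> (Y -` B \<inter> space M)) \<omega> \<partial>M)"
      unfolding set_lebesgue_integral_def
      by (rule Bochner_Integration.integral_cong) (auto simp: f_def indicator_def)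
    also have "\<dots> = measure M (A \<inter> (Y -` B \<inter> space M))"
      using GM[OF A] measurable_sets[OF Y B] by simp
    finally show ?thesis by (simp add: emeasure_eq_measure)
  qed
  have eq: "(\<integral>\<^sup>+\<omega>. emeasure (\<kappa> \<omega>) B * indicator A \<omega> \<partial>M) = emeasure M (A \<inter> (Y -` B \<inter> space M))
      \<longleftrightarrow> (\<integral>\<omega>\<in>A. measure (\<kappa> \<omega>) B \<partial>M) = (\<integral>\<omega>\<in>A. f \<omega> \<partial>M)" if A: "A \<in> sets G" for A
    unfolding lhs[OF A] rhs[OF A] set_lebesgue_integral_def
    by (subst ennreal_inj) (auto intro!: integral_nonneg simp: f_def indicator_def)
  show ?thesis
    unfolding f_def[symmetric]
  proof
    assume AE: "AE \<omega> in M. measure (\<kappa> \<omega>) B = real_cond_exp M G f \<omega>"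
    show "\<forall>A\<in>sets G. (\<integral>\<^sup>+\<omega>. emeasure (\<kappa> \<omega>) B * indicator A \<omega> \<partial>M) = emeasure M (A \<inter> (Y -` B \<inter> space M))"
    proof
      fix A assume A: "A \<in> sets G"
      have "(\<integral>\<omega>\<in>A. measure (\<kappa> \<omega>) B \<partial>M) = (\<integral>\<omega>\<in>A. real_cond_exp M G f \<omega> \<partial>M)"
        using AE GM[OF A] p_measM by (intro set_lebesgue_integral_cong_AE) (auto intro: borel_measurable_cond_exp2)
      then show "(\<integral>\<^sup>+\<omega>. emeasure (\<kappa> \<omega>) B * indicator A \<omega> \<partial>M) = emeasure M (A \<inter> (Y -` B \<inter> space M))"
        unfolding eq[OF A] using G.real_cond_exp_intA[OF f_int A] by simp
    qed
  next
    assume int: "\<forall>A\<in>sets G. (\<integral>\<^sup>+\<omega>. emeasure (\<kappa> \<omega>) B * indicator A \<omega> \<partial>M) = emeasure M (A \<inter> (Y -` B \<inter> space M))"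
    have "AE \<omega> in M. real_cond_exp M G f \<omega> = measure (\<kappa> \<omega>) B"
      using int eq by (intro G.real_cond_exp_charact f_int p_int p_meas) auto
    then show "AE \<omega> in M. measure (\<kappa> \<omega>) B = real_cond_exp M G f \<omega>" by auto
  qed
qed

lemma (in prob_space) regular_cond_law_iff:
  "regular_cond_law M G N Y \<kappa> \<longleftrightarrow>
     subalgebra M G \<and> Y \<in> M \<rightarrow>\<^sub>M N \<and> \<kappa> \<in> G \<rightarrow>\<^sub>M prob_algebra N \<and>
     (\<forall>B\<in>sets N. \<forall>A\<in>sets G.
        (\<integral>\<^sup>+\<omega>. emeasure (\<kappa> \<omega>) B * indicator A \<omega> \<partial>M) = emeasure M (A \<inter> (Y -` B \<inter> space M)))"
  unfolding regular_cond_law_def using cond_law_iff by blast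

text \<open>Pushing the kernel forward amounts to taking preimages in the integrated identity. With
  \<open>U\<close> a real code of \<open>Y\<close> and \<open>\<psi>\<close> the decoding map, a
  conditional law on the line is carried to the space of \<open>Y\<close>.\<close>

lemma (in prob_space) regular_cond_law_transfer:
  assumes \<kappa>: "regular_cond_law M G N U \<kappa>" and \<psi>: "\<psi> \<in> N \<rightarrow>\<^sub>M N'"
    and Y: "\<And>\<omega>. \<omega> \<in> space M \<Longrightarrow> Y \<omega> = \<psi> (U \<omega>)"
  shows "regular_cond_law M G N' Y (\<lambda>\<omega>. distr (\<kappa> \<omega>) N' \<psi>)"
  unfolding regular_cond_law_iff
proof (intro conjI ballI)
  note K = \<kappa>[unfolded regular_cond_law_iff]
  show G: "subalgebra M G" using K by simp
  have U: "U \<in> M \<rightarrow>\<^sub>M N" using K by simp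
  show "Y \<in> M \<rightarrow>\<^sub>M N'"
    using measurable_compose[OF U \<psi>] by (subst measurable_cong[OF Y]) auto
  have K_meas: "\<kappa> \<in> G \<rightarrow>\<^sub>M prob_algebra N" using K by simp
  show "(\<lambda>\<omega>. distr (\<kappa> \<omega>) N' \<psi>) \<in> G \<rightarrow>\<^sub>M prob_algebra N'"
    using measurable_compose[OF K_meas measurable_distr_prob_space[OF \<psi>]] .
  fix B A assume B: "B \<in> sets N'" and A: "A \<in> sets G"
  have sets_\<kappa>: "sets (\<kappa> \<omega>) = sets N" if "\<omega> \<in> space M" for \<omega>
    using measurable_space[OF K_meas, of \<omega>] that G by (simp add: subalgebra_def space_prob_algebra)
  have "(\<integral>\<^sup>+\<omega>. emeasure (distr (\<kappa> \<omega>) N' \<psi>) B * indicator A \<omega> \<partial>M)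
      = (\<integral>\<^sup>+\<omega>. emeasure (\<kappa> \<omega>) (\<psi> -` B \<inter> space N) * indicator A \<omega> \<partial>M)"
  proof (rule nn_integral_cong)
    fix \<omega> assume \<omega>: "\<omega> \<in> space M"
    note [measurable_cong] = sets_\<kappa>[OF \<omega>]
    show "emeasure (distr (\<kappa> \<omega>) N' \<psi>) B * indicator A \<omega>
        = emeasure (\<kappa> \<omega>) (\<psi> -` B \<inter> space N) * indicator A \<omega>"
      using \<psi> B sets_eq_imp_space_eq[OF sets_\<kappa>[OF \<omega>]] by (subst emeasure_distr) simp_all
  qed
  also have "\<dots> = emeasure M (A \<inter> (U -` (\<psi> -` B \<inter> space N) \<inter> space M))"
    using K A measurable_sets[OF \<psi> B] by simp
  also have "U -` (\<psi> -` B \<inter> space N) \<inter> space M = Y -` B \<inter> space M"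
    using measurable_space[OF U] Y by auto
  finally show "(\<integral>\<^sup>+\<omega>. emeasure (distr (\<kappa> \<omega>) N' \<psi>) B * indicator A \<omega> \<partial>M)
      = emeasure M (A \<inter> (Y -` B \<inter> space M))" .
qed

text \<open>The kernel has distribution function \<open>x \<mapsto> INF q > x. P(U \<le> q | G)\<close>, where \<open>q\<close> runs over the
  rationals.\<close>

lemma (in prob_space) ex_regular_cond_law_unit_interval:
  fixes U :: "'a \<Rightarrow> real"
  assumes G: "subalgebra M G" and U[measurable]: "U \<in> borel_measurable M"
    and U01: "\<And>\<omega>. \<omega> \<in> space M \<Longrightarrow> U \<omega> \<in> {0..1}"
  obtains \<kappa> where "regular_cond_law M G borel U \<kappa>"
proof -
  interpret G: finite_measure_subalgebra M G
    by (rule subalgebra_imp_finite_measure_subalgebra[OF G])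
  have GM: "A \<in> sets M" if "A \<in> sets G" for A using that G by (auto simp: subalgebra_def)
  define i where "i q = (\<lambda>\<omega>. indicator {..q} (U \<omega>) :: real)" for q
  have [measurable]: "i q \<in> borel_measurable M" for q by (simp add: i_def)
  have i_int: "integrable M (i q)" for q
    by (rule integrable_const_bound[of _ 1]) (auto simp: i_def indicator_def)
  define p0 where "p0 q = real_cond_exp M G (i q)" for q
  have p0_meas[measurable]: "p0 q \<in> borel_measurable G" for q by (simp add: p0_def)
  have p0_int: "(\<integral>\<omega>\<in>A. p0 q \<omega> \<partial>M) = measure M (A \<inter> {\<omega>\<in>space M. U \<omega> \<le> q})" if A: "A \<in> sets G" for A q
  proof -
    have "(\<integral>\<omega>\<in>A. p0 q \<omega> \<partial>M) = (\<integral>\<omega>\<in>A. i q \<omega> \<partial>M)"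
      unfolding p0_def by (rule G.real_cond_exp_intA[symmetric, OF i_int A])
    also have "\<dots> = (\<integral>\<omega>. indicator (A \<inter> {\<omega>\<in>space M. U \<omega> \<le> q}) \<omega> \<partial>M)"
      unfolding set_lebesgue_integral_def
      by (rule Bochner_Integration.integral_cong) (auto simp: i_def indicator_def)
    also have "\<dots> = measure M (A \<inter> {\<omega>\<in>space M. U \<omega> \<le> q})"
      using GM[OF A] by simp
    finally show ?thesis .
  qed
  have p0_mono: "AE \<omega> in M. p0 q \<omega> \<le> p0 r \<omega>" if "q \<le> r" for q r
    unfolding p0_def using that
    by (intro G.real_cond_exp_mono i_int) (auto simp: i_def indicator_def)
  have const: "AE \<omega> in M. p0 q \<omega> = c" if "\<And>\<omega>. \<omega> \<in> space M \<Longrightarrow> i q \<omega> = c" for q c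
  proof -
    have "AE \<omega> in M. p0 q \<omega> = real_cond_exp M G (\<lambda>_. c) \<omega>"
      unfolding p0_def using that by (intro G.real_cond_exp_cong) auto
    moreover have "AE \<omega> in M. real_cond_exp M G (\<lambda>_. c) \<omega> = c"
      by (intro G.real_cond_exp_F_meas) auto
    ultimately show ?thesis by eventually_elim simp
  qed
  have p0_0: "AE \<omega> in M. p0 q \<omega> = 0" if "q < 0" for q
    using that U01 by (intro const) (force simp: i_def indicator_def)
  have p0_1: "AE \<omega> in M. p0 q \<omega> = 1" if "1 \<le> q" for q
    using that U01 by (intro const) (force simp: i_def indicator_def)
  define good where "good \<omega> \<longleftrightarrow> (\<forall>q\<in>\<rat>. \<forall>r\<in>\<rat>. (q \<le> r \<longrightarrow> p0 q \<omega> \<le> p0 r \<omega>)) \<and>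
      (\<forall>q\<in>\<rat>. (q < 0 \<longrightarrow> p0 q \<omega> = 0) \<and> (1 \<le> q \<longrightarrow> p0 q \<omega> = 1))" for \<omega>
  have [measurable]: "Measurable.pred G good"
    unfolding good_def using countable_rat by measurable
  have good_AE: "AE \<omega> in M. good \<omega>"
    unfolding good_def AE_conj_iff AE_ball_countable[OF countable_rat]
    using p0_mono p0_0 p0_1 by (intro conjI ballI AE_impI)
  \<comment> \<open>Where \<open>good\<close> fails, which is a null event of \<open>G\<close>, the
    distribution function of the point mass at 0 is the default. Monotonicity and the limits then
    hold for every \<omega>, so the kernel consists of probabilities throughout.\<close>
  define p where "p q \<omega> = (if good \<omega> then p0 q \<omega> else indicator {0..} q)" for q \<omega>
  have p_meas[measurable]: "p q \<in> borel_measurable G" for q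
    unfolding p_def by measurable
  have p_AE: "AE \<omega> in M. p q \<omega> = p0 q \<omega>" for q
    using good_AE by eventually_elim (simp add: p_def)
  have p_mono: "p q \<omega> \<le> p r \<omega>" if "q \<in> \<rat>" "r \<in> \<rat>" "q \<le> r" for q r \<omega>
    using that by (auto simp: p_def good_def indicator_def)
  have p_0: "p q \<omega> = 0" if "q \<in> \<rat>" "q < 0" for q \<omega>
    using that by (auto simp: p_def good_def)
  have p_1: "p q \<omega> = 1" if "q \<in> \<rat>" "1 \<le> q" for q \<omega>
    using that by (auto simp: p_def good_def)
  have p_nonneg: "0 \<le> p q \<omega>" if q: "q \<in> \<rat>" for q \<omega>
    using p_0[of "-1" \<omega>] p_mono[of "-1" q \<omega>] p_0[OF q] q by (cases "q < 0") auto
  \<comment> \<open>The strict inequality makes the infimum over \<open>Q x\<close> right-continuous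
    in \<open>x\<close>; at a rational \<open>x\<close> it may exceed \<open>p x\<close>.\<close>
  define Q where "Q x = {q\<in>\<rat>. x < q}" for x :: real
  have Q_ne: "Q x \<noteq> {}" for x
    using Rats_dense_in_real[of x "x + 1"] by (auto simp: Q_def)
  have Q_count: "countable (Q x)" for x
    unfolding Q_def by (rule countable_subset[OF _ countable_rat]) auto
  have bdd: "bdd_below ((\<lambda>q. p q \<omega>) ` Q x)" for x \<omega>
    using p_nonneg by (auto simp: Q_def intro!: bdd_belowI[of _ 0])
  define F where "F \<omega> x = (INF q\<in>Q x. p q \<omega>)" for \<omega> x
  have F_le: "F \<omega> x \<le> p q \<omega>" if "q \<in> \<rat>" "x < q" for \<omega> x q
    unfolding F_def using that by (intro cINF_lower bdd) (auto simp: Q_def)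
  have F_ge: "c \<le> F \<omega> x" if "\<And>q. q \<in> \<rat> \<Longrightarrow> x < q \<Longrightarrow> c \<le> p q \<omega>" for \<omega> x c
    unfolding F_def using that by (intro cINF_greatest Q_ne) (auto simp: Q_def)
  have F_mono: "F \<omega> x \<le> F \<omega> y" if "x \<le> y" for \<omega> x y
    using that by (intro F_ge F_le) auto
  have F_nonneg: "0 \<le> F \<omega> x" for \<omega> x by (intro F_ge p_nonneg)
  have F_0: "F \<omega> x = 0" if x: "x < 0" for \<omega> x
  proof -
    obtain q where "q \<in> \<rat>" "x < q" "q < 0" using Rats_dense_in_real[OF x] by auto
    then show ?thesis using F_le[of q x \<omega>] p_0[of q \<omega>] F_nonneg[of \<omega> x] by simp
  qed
  have F_1: "F \<omega> x = 1" if x: "1 \<le> x" for \<omega> x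
  proof -
    obtain q where "q \<in> \<rat>" "x < q" using Rats_dense_in_real[of x "x+1"] by auto
    then have "F \<omega> x \<le> 1" using F_le[of q x \<omega>] p_1[of q \<omega>] x by simp
    moreover have "1 \<le> F \<omega> x" using p_1 x by (intro F_ge) auto
    ultimately show ?thesis by simp
  qed
  have F_right: "continuous (at_right x) (F \<omega>)" for \<omega> x
    unfolding continuous_within
  proof (rule order_tendstoI)
    fix c assume "c < F \<omega> x"
    then show "eventually (\<lambda>y. c < F \<omega> y) (at_right x)"
      unfolding eventually_at_right_field
      using F_mono[of x _ \<omega>] by (intro exI[of _ "x + 1"]) (auto intro: order.strict_trans2)
  next
    fix c assume "F \<omega> x < c"
    then obtain q where q: "q \<in> \<rat>" "x < q" "p q \<omega> < c"
      unfolding F_def using cINF_less_iff[OF Q_ne bdd] by (auto simp: Q_def)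
    show "eventually (\<lambda>y. F \<omega> y < c) (at_right x)"
      unfolding eventually_at_right_field
      using q by (intro exI[of _ q]) (auto intro: le_less_trans[OF F_le])
  qed
  have F_bot: "(F \<omega> \<longlongrightarrow> 0) at_bot" for \<omega>
    by (rule tendsto_eventually) (use F_0 eventually_at_bot_dense in blast)
  have F_top: "(F \<omega> \<longlongrightarrow> 1) at_top" for \<omega>
    by (rule tendsto_eventually) (use F_1 eventually_at_top_linorder in blast)
  define \<kappa> where "\<kappa> \<omega> = interval_measure (F \<omega>)" for \<omega>
  have dist: "real_distribution (\<kappa> \<omega>)" for \<omega>
    unfolding \<kappa>_def by (intro real_distribution_interval_measure F_mono F_right F_bot F_top)
  have cdf: "measure (\<kappa> \<omega>) {..x} = F \<omega> x" for \<omega> x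
    using cdf_interval_measure[OF F_mono F_right F_bot, of \<omega>] unfolding \<kappa>_def cdf_def by metis
  have \<kappa>_prob: "prob_space (\<kappa> \<omega>)" for \<omega> using dist by (simp add: real_distribution_def)
  have \<kappa>_sets: "sets (\<kappa> \<omega>) = sets borel" for \<omega> by (simp add: \<kappa>_def)
  have em_cdf: "emeasure (\<kappa> \<omega>) {..x} = ennreal (F \<omega> x)" for \<omega> x
    using finite_measure.emeasure_eq_measure[OF prob_space.finite_measure[OF \<kappa>_prob]] cdf by simp
  have F_meas[measurable]: "(\<lambda>\<omega>. F \<omega> x) \<in> borel_measurable G" for x
    unfolding F_def using Q_count by measurable
  have gen: "sets (borel :: real measure) = sigma_sets UNIV (range atMost)"
    by (subst borel_eq_atMost) (simp add: sets_measure_of)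
  have stable: "Int_stable (range (atMost :: real \<Rightarrow> _))"
    by (auto simp: Int_stable_def)
  have \<kappa>_meas: "\<kappa> \<in> G \<rightarrow>\<^sub>M prob_algebra borel"
  proof (rule measurable_prob_algebra_generated[OF gen stable])
    fix A assume "A \<in> range (atMost :: real \<Rightarrow> _)"
    then show "(\<lambda>\<omega>. emeasure (\<kappa> \<omega>) A) \<in> borel_measurable G"
      by (auto simp: em_cdf)
  qed (use \<kappa>_prob \<kappa>_sets in auto)
  have half: "(\<integral>\<^sup>+\<omega>. emeasure (\<kappa> \<omega>) {..x} * indicator A \<omega> \<partial>M)
      = emeasure M (A \<inter> {\<omega>\<in>space M. U \<omega> \<le> x})" if A: "A \<in> sets G" for A x
  proof -
    have A'[measurable]: "A \<in> sets M" by (rule GM[OF A])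
    have F_le1: "F \<omega> y \<le> 1" for \<omega> y using F_mono[of y "max y 1" \<omega>] F_1[of "max y 1" \<omega>] by simp
    have FM[measurable]: "(\<lambda>\<omega>. F \<omega> x) \<in> borel_measurable M"
      by (rule measurable_from_subalg[OF G F_meas])
    have p0M[measurable]: "p0 q \<in> borel_measurable M" for q
      by (rule measurable_from_subalg[OF G p0_meas])
    have F_int: "integrable M (\<lambda>\<omega>. F \<omega> x)"
      by (rule integrable_const_bound[of _ 1]) (use F_le1 F_nonneg in auto)
    have p0_int': "integrable M (p0 q)" for q
      unfolding p0_def by (rule G.real_cond_exp_int(1)[OF i_int])
    have set_int: "integrable M (\<lambda>\<omega>. indicator A \<omega> * h \<omega>)" if "integrable M h" for h :: "'a \<Rightarrow> real"
      using integrable_mult_indicator[OF A' that] by simp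
    have "(\<integral>\<^sup>+\<omega>. emeasure (\<kappa> \<omega>) {..x} * indicator A \<omega> \<partial>M) = (\<integral>\<^sup>+\<omega>. ennreal (indicator A \<omega> * F \<omega> x) \<partial>M)"
      by (rule nn_integral_cong) (simp add: em_cdf indicator_def)
    also have "\<dots> = ennreal (\<integral>\<omega>\<in>A. F \<omega> x \<partial>M)"
      unfolding set_lebesgue_integral_def
      by (subst nn_integral_eq_integral) (use F_nonneg set_int[OF F_int] in auto)
    also have "(\<integral>\<omega>\<in>A. F \<omega> x \<partial>M) = measure M (A \<inter> {\<omega>\<in>space M. U \<omega> \<le> x})"
    proof (rule antisym)
      have "AE \<omega> in M. \<forall>q\<in>Q x. p0 x \<omega> \<le> p q \<omega>"
        unfolding AE_ball_countable[OF Q_count]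
      proof
        fix q assume "q \<in> Q x"
        then have "AE \<omega> in M. p0 x \<omega> \<le> p0 q \<omega>" by (intro p0_mono) (simp add: Q_def)
        with p_AE[of q] show "AE \<omega> in M. p0 x \<omega> \<le> p q \<omega>" by eventually_elim simp
      qed
      then have AE: "AE \<omega> in M. p0 x \<omega> \<le> F \<omega> x"
        by eventually_elim (auto intro!: F_ge simp: Q_def)
      have "measure M (A \<inter> {\<omega>\<in>space M. U \<omega> \<le> x}) = (\<integral>\<omega>\<in>A. p0 x \<omega> \<partial>M)"
        by (rule p0_int[symmetric, OF A])
      also have "\<dots> \<le> (\<integral>\<omega>\<in>A. F \<omega> x \<partial>M)"
        unfolding set_lebesgue_integral_def real_scaleR_def
      proof (rule integral_mono_AE[OF set_int[OF p0_int'] set_int[OF F_int]])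
        show "AE \<omega> in M. indicator A \<omega> * p0 x \<omega> \<le> indicator A \<omega> * F \<omega> x"
          using AE by eventually_elim (auto simp: indicator_def)
      qed
      finally show "measure M (A \<inter> {\<omega>\<in>space M. U \<omega> \<le> x}) \<le> (\<integral>\<omega>\<in>A. F \<omega> x \<partial>M)" .
      \<comment> \<open>For the reverse inequality, \<open>F\<close> at \<open>x\<close> lies below
        \<open>p q\<close> for a rational \<open>q\<close> less than \<open>x + 1 / Suc n\<close>,
        and the events \<open>D n\<close> decrease to the part of \<open>A\<close> where
        \<open>U\<close> is at most \<open>x\<close>.\<close>
      define D where "D n = A \<inter> {\<omega>\<in>space M. U \<omega> \<le> x + 1 / Suc n}" for n
      have D[measurable]: "D n \<in> sets M" for n unfolding D_def by measurable
      have "(\<integral>\<omega>\<in>A. F \<omega> x \<partial>M) \<le> measure M (D n)" for n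
      proof -
        obtain q where q: "q \<in> \<rat>" "x < q" "q < x + 1 / Suc n"
          using Rats_dense_in_real[of x "x + 1 / Suc n"] by auto
        have "(\<integral>\<omega>\<in>A. F \<omega> x \<partial>M) \<le> (\<integral>\<omega>\<in>A. p0 q \<omega> \<partial>M)"
          unfolding set_lebesgue_integral_def real_scaleR_def
        proof (rule integral_mono_AE[OF set_int[OF F_int] set_int[OF p0_int']])
          show "AE \<omega> in M. indicator A \<omega> * F \<omega> x \<le> indicator A \<omega> * p0 q \<omega>"
            using p_AE[of q]
          proof eventually_elim
            case (elim \<omega>)
            then show ?case using F_le[OF q(1,2), of \<omega>] by (auto simp: indicator_def)
          qed
        qed
        also have "\<dots> = measure M (A \<inter> {\<omega>\<in>space M. U \<omega> \<le> q})" by (rule p0_int[OF A])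
        also have "\<dots> \<le> measure M (D n)"
          using q by (intro finite_measure_mono) (auto simp: D_def)
        finally show ?thesis .
      qed
      moreover have "(\<lambda>n. measure M (D n)) \<longlonglongrightarrow> measure M (\<Inter>n. D n)"
      proof (rule finite_Lim_measure_decseq)
        show "range D \<subseteq> sets M" using D by auto
        show "decseq D"
        proof (rule decseq_SucI)
          fix n
          have "1 / real (Suc (Suc n)) \<le> 1 / Suc n" by (simp add: frac_le)
          then show "D (Suc n) \<subseteq> D n" unfolding D_def by auto
        qed
      qed
      ultimately have "(\<integral>\<omega>\<in>A. F \<omega> x \<partial>M) \<le> measure M (\<Inter>n. D n)"
        by (intro LIMSEQ_le_const) auto
      also have "(\<Inter>n. D n) = A \<inter> {\<omega>\<in>space M. U \<omega> \<le> x}"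
      proof -
        have "U \<omega> \<le> x" if le: "\<And>n. U \<omega> \<le> x + 1 / Suc n" for \<omega>
        proof (rule field_le_epsilon)
          fix e :: real assume "e > 0"
          then obtain n where "1 / Suc n < e" using nat_approx_posE by blast
          with le[of n] show "U \<omega> \<le> x + e" by linarith
        qed
        then show ?thesis unfolding D_def by (auto intro: order_trans)
      qed
      finally show "(\<integral>\<omega>\<in>A. F \<omega> x \<partial>M) \<le> measure M (A \<inter> {\<omega>\<in>space M. U \<omega> \<le> x})" .
    qed
    finally show ?thesis by (simp add: emeasure_eq_measure)
  qed
  have "regular_cond_law M G borel U \<kappa>"
    unfolding regular_cond_law_iff
  proof (intro conjI ballI G U \<kappa>_meas)
    fix B :: "real set" and A assume B: "B \<in> sets borel" and A: "A \<in> sets G"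
    have A'[measurable]: "A \<in> sets M" by (rule GM[OF A])
    \<comment> \<open>For fixed \<open>A\<close>, both sides are finite measures in
      \<open>B\<close>. They agree on half-lines by \<open>half\<close>, hence on all Borel sets,
      the half-lines being an intersection-stable generator.\<close>
    let ?MA = "density M (indicator A)"
    have \<kappa>_sub: "\<kappa> \<in> ?MA \<rightarrow>\<^sub>M subprob_algebra borel"
      using measurable_from_subalg[OF G measurable_prob_algebraD[OF \<kappa>_meas]] by simp
    have ne: "space ?MA \<noteq> {}" using not_empty by simp
    have bind: "emeasure (?MA \<bind> \<kappa>) C = (\<integral>\<^sup>+\<omega>. emeasure (\<kappa> \<omega>) C * indicator A \<omega> \<partial>M)"
      if C: "C \<in> sets borel" for C
    proof -
      have [measurable]: "(\<lambda>\<omega>. emeasure (\<kappa> \<omega>) C) \<in> borel_measurable M"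
        using measurable_compose[OF \<kappa>_sub measurable_emeasure_subprob_algebra[OF C]] by simp
      show ?thesis
        unfolding emeasure_bind[OF ne \<kappa>_sub C]
        by (subst nn_integral_density) (auto simp: mult.commute)
    qed
    have distr: "emeasure (distr ?MA borel U) C = emeasure M (A \<inter> (U -` C \<inter> space M))"
      if C: "C \<in> sets borel" for C
      using C by (subst emeasure_distr) (auto simp: emeasure_restricted)
    have "?MA \<bind> \<kappa> = distr ?MA borel U"
    proof (rule measure_eqI_generator_eq[OF stable, where \<Omega>=UNIV and A="\<lambda>n. {..real n}"])
      have "sets (?MA \<bind> \<kappa>) = sets (borel :: real measure)"
        by (rule sets_bind[OF _ ne]) (simp add: \<kappa>_sets)
      then show "sets (?MA \<bind> \<kappa>) = sigma_sets UNIV (range atMost)" using gen by simp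
      show "sets (distr ?MA borel U) = sigma_sets UNIV (range atMost)" using gen by simp
      show "(\<Union>n. {..real n}) = UNIV" using real_arch_simple by auto
      fix C assume "C \<in> range (atMost :: real \<Rightarrow> _)"
      then obtain x where C: "C = {..x}" by auto
      have "U -` {..x} \<inter> space M = {\<omega> \<in> space M. U \<omega> \<le> x}" by auto
      then show "emeasure (?MA \<bind> \<kappa>) C = emeasure (distr ?MA borel U) C"
        using half[OF A, of x] by (simp add: C bind distr)
    next
      fix n :: nat
      show "emeasure (?MA \<bind> \<kappa>) {..real n} \<noteq> \<infinity>"
        using half[OF A, of n] by (simp add: bind)
    qed auto
    then show "(\<integral>\<^sup>+\<omega>. emeasure (\<kappa> \<omega>) B * indicator A \<omega> \<partial>M) = emeasure M (A \<inter> (U -` B \<inter> space M))"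
      using bind[OF B] distr[OF B] by simp
  qed
  then show thesis by (rule that)
qed

text \<open>Bits are written in base 4, so that no two bit sequences share a code.\<close>

definition binary_code :: "(nat \<Rightarrow> bool) \<Rightarrow> real" where
  "binary_code b = (\<Sum>i. of_bool (b i) / 4 ^ Suc i)"

definition binary_digit :: "nat \<Rightarrow> real \<Rightarrow> bool" where
  "binary_digit i x \<longleftrightarrow> \<lfloor>4 ^ Suc i * x\<rfloor> mod 4 = 1"

lemma summable_binary_code: "summable (\<lambda>i. of_bool (b i) / 4 ^ Suc i :: real)"
proof (rule summable_comparison_test')
  show "summable (\<lambda>i. (1/4) ^ i :: real)" by (rule summable_geometric) simp
  show "norm (of_bool (b i) / 4 ^ Suc i :: real) \<le> (1/4) ^ i" if "i \<ge> 0" for i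
    by (simp add: power_divide field_simps)
qed

lemma binary_code_bounds: "0 \<le> binary_code b" "binary_code b \<le> 1/3"
proof -
  show "0 \<le> binary_code b"
    unfolding binary_code_def by (intro suminf_nonneg summable_binary_code) auto
  have "(\<lambda>i. (1/4) * (1/4) ^ i :: real) sums ((1/4) * (1 / (1 - 1/4)))"
    by (intro sums_mult geometric_sums) simp
  then have s: "(\<lambda>i. (1/4) ^ Suc i :: real) sums (1/3)" by simp
  have "binary_code b \<le> (\<Sum>i. (1/4) ^ Suc i)"
    unfolding binary_code_def
  proof (rule suminf_le[OF _ summable_binary_code sums_summable[OF s]])
    show "of_bool (b i) / 4 ^ Suc i \<le> (1/4 :: real) ^ Suc i" for i
      by (simp add: power_divide)
  qed
  then show "binary_code b \<le> 1/3" using sums_unique[OF s] by simp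
qed

lemma binary_code_unfold: "4 * binary_code b = of_bool (b 0) + binary_code (\<lambda>i. b (Suc i))"
proof -
  have "binary_code b = of_bool (b 0) / 4 + (\<Sum>i. of_bool (b (Suc i)) / 4 ^ Suc (Suc i))"
    unfolding binary_code_def using suminf_split_head[OF summable_binary_code, of b] by simp
  also have "(\<Sum>i. of_bool (b (Suc i)) / 4 ^ Suc (Suc i) :: real)
      = (\<Sum>i. (of_bool (b (Suc i)) / 4 ^ Suc i) / 4)"
    by (simp add: field_simps)
  also have "\<dots> = binary_code (\<lambda>i. b (Suc i)) / 4"
    unfolding binary_code_def by (rule suminf_divide[OF summable_binary_code])
  finally show ?thesis by simp
qed

text \<open>After multiplication by 4 the tail of the code is still at most 1/3, so no carry occurs
  and the integer part is the first bit. In later digits that bit contributes a multiple of 4, which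
  \<open>mod\<close> discards, so the induction can shift the sequence.\<close>

lemma binary_digit_code: "binary_digit i (binary_code b) = b i"
proof (induction i arbitrary: b)
  case 0
  have "\<lfloor>4 * binary_code b\<rfloor> = of_bool (b 0)"
    using binary_code_bounds[of "\<lambda>i. b (Suc i)"]
    unfolding binary_code_unfold by (auto intro!: floor_unique)
  then show ?case by (simp add: binary_digit_def)
next
  case (Suc i)
  let ?b = "\<lambda>i. b (Suc i)"
  have "4 ^ Suc (Suc i) * binary_code b = 4 ^ Suc i * (4 * binary_code b)" by simp
  also have "\<dots> = 4 ^ Suc i * binary_code ?b + of_int (4 * (4 ^ i * of_bool (b 0)))"
    unfolding binary_code_unfold by (simp add: algebra_simps)
  finally have "\<lfloor>4 ^ Suc (Suc i) * binary_code b\<rfloor> = \<lfloor>4 ^ Suc i * binary_code ?b\<rfloor> + 4 * (4 ^ i * of_bool (b 0))"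
    by linarith
  then have "\<lfloor>4 ^ Suc (Suc i) * binary_code b\<rfloor> mod 4 = \<lfloor>4 ^ Suc i * binary_code ?b\<rfloor> mod 4"
    by simp
  then show ?case using Suc[of ?b] by (simp add: binary_digit_def)
qed

lemma measurable_binary_digit [measurable]: "Measurable.pred borel (binary_digit i)"
  unfolding binary_digit_def by measurable

section \<open>Borel sets of a metric, and complete separable spaces as Borel retracts of the
  line\<close>

lemma openin_mtopology_of_subset: "openin (mtopology_of m) U \<Longrightarrow> U \<subseteq> mspace m"
  using openin_subset[of "mtopology_of m" U] by simp

lemma space_borel_of_metric [simp]: "space (borel_of_metric m) = mspace m"
  unfolding borel_of_metric_def
  by (rule space_measure_of) (auto dest: openin_mtopology_of_subset)

lemma sets_borel_of_metric:
  "sets (borel_of_metric m) = sigma_sets (mspace m) {U. openin (mtopology_of m) U}"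
  unfolding borel_of_metric_def
  by (rule sets_measure_of) (auto dest: openin_mtopology_of_subset)

lemma openin_borel_of_metric: "openin (mtopology_of m) U \<Longrightarrow> U \<in> sets (borel_of_metric m)"
  by (simp add: sets_borel_of_metric sigma_sets.Basic)

lemma closedin_borel_of_metric: "closedin (mtopology_of m) C \<Longrightarrow> C \<in> sets (borel_of_metric m)"
proof -
  assume C: "closedin (mtopology_of m) C"
  then have "mspace m - C \<in> sets (borel_of_metric m)"
    by (intro openin_borel_of_metric) (auto simp: closedin_def)
  then have "space (borel_of_metric m) - (mspace m - C) \<in> sets (borel_of_metric m)"
    by (intro sets.compl_sets) 
  moreover have "C \<subseteq> mspace m" using closedin_subset[OF C] by simp
  ultimately show ?thesis by (simp add: double_diff)
qed

lemma openin_mball_of: "openin (mtopology_of m) (mball_of m x r)"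
  unfolding mtopology_of_def mball_of_def
  by (rule Metric_space.openin_mball[OF Metric_space_mspace_mdist])

lemma measurable_borel_of_metricI:
  assumes "\<And>x. x \<in> space M \<Longrightarrow> f x \<in> mspace m"
    and "\<And>U. openin (mtopology_of m) U \<Longrightarrow> f -` U \<inter> space M \<in> sets M"
  shows "f \<in> M \<rightarrow>\<^sub>M borel_of_metric m"
  by (rule measurable_sigma_sets[OF sets_borel_of_metric])
    (use assms in \<open>auto dest: openin_mtopology_of_subset\<close>)

lemma openin_mtopology_of_iff:
  "openin (mtopology_of m) U \<longleftrightarrow> U \<subseteq> mspace m \<and> (\<forall>x\<in>U. \<exists>r>0. mball_of m x r \<subseteq> U)"
  unfolding mtopology_of_def mball_of_def
  by (simp add: Metric_space.openin_mtopology[OF Metric_space_mspace_mdist] Ball_def)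

text \<open>The steps sum to a geometric tail. The explicit rate is the point: it later lets one
  term of the sequence locate the limit. The factor 2 leaves room for consecutive terms within
  \<open>(1/2) ^ j\<close> and \<open>(1/2) ^ Suc j\<close> of a common point.\<close>

lemma mcomplete_of_fast_limit:
  assumes m: "mcomplete_of m" and s: "\<And>j. s j \<in> mspace m"
    and fast: "\<And>j. mdist m (s j) (s (Suc j)) \<le> 2 * (1/2) ^ j"
  obtains y where "y \<in> mspace m" "\<And>j. mdist m (s j) y \<le> 4 * (1/2) ^ j"
proof -
  interpret Metric_space "mspace m" "mdist m" by (rule Metric_space_mspace_mdist)
  have inc: "mdist m (s j) (s (j + k)) \<le> 4 * (1/2) ^ j - 4 * (1/2) ^ (j + k)" for j k
  proof (induction k)
    case 0
    then show ?case using s by simp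
  next
    case (Suc k)
    have "mdist m (s j) (s (j + Suc k)) \<le> mdist m (s j) (s (j + k)) + mdist m (s (j + k)) (s (Suc (j + k)))"
      using triangle s by simp
    with Suc fast[of "j + k"] show ?case by simp
  qed
  have dist: "mdist m (s j) (s k) \<le> 4 * (1/2) ^ min j k" for j k
  proof -
    have le: "mdist m (s j) (s k) \<le> 4 * (1/2) ^ j" if "j \<le> k" for j k
    proof -
      have "0 \<le> 4 * (1/2 :: real) ^ k" by simp
      moreover have "mdist m (s j) (s k) \<le> 4 * (1/2) ^ j - 4 * (1/2) ^ k"
        using inc[of j "k - j"] that by simp
      ultimately show ?thesis by linarith
    qed
    show ?thesis using le[of j k] le[of k j] commute[of "s j" "s k"] by (cases "j \<le> k") (auto simp: min_def)
  qed
  have small: "\<exists>N. 4 * (1/2 :: real) ^ N < e" if "e > 0" for e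
    using real_arch_pow_inv[of "e / 4" "1/2"] that by (auto simp: mult.commute)
  have "MCauchy s"
    unfolding MCauchy_def
  proof (intro conjI allI impI)
    fix e :: real assume "e > 0"
    then obtain N where N: "4 * (1/2 :: real) ^ N < e" using small by blast
    have "mdist m (s n) (s n') < e" if "N \<le> n" "N \<le> n'" for n n'
    proof -
      have "(1/2 :: real) ^ min n n' \<le> (1/2) ^ N" using that by (intro power_decreasing) auto
      then show ?thesis using dist[of n n'] N by linarith
    qed
    then show "\<exists>N. \<forall>n n'. N \<le> n \<longrightarrow> N \<le> n' \<longrightarrow> mdist m (s n) (s n') < e" by blast
  qed (use s in auto)
  then obtain y where y: "limitin mtopology s y sequentially"
    using m unfolding mcomplete_of_def mcomplete_def by blast
  then have yM: "y \<in> mspace m" by (rule limitin_mspace)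
  show thesis
  proof (rule that[OF yM], rule field_le_epsilon)
    fix j and e :: real assume "e > 0"
    then have "eventually (\<lambda>n. s n \<in> mspace m \<and> mdist m (s n) y < e) sequentially"
      using y unfolding limitin_metric by blast
    then obtain N where N: "\<And>n. n \<ge> N \<Longrightarrow> mdist m (s n) y < e"
      unfolding eventually_sequentially by blast
    have "mdist m (s j) y \<le> mdist m (s j) (s (max j N)) + mdist m (s (max j N)) y"
      using triangle s yM by blast
    also have "\<dots> \<le> 4 * (1/2) ^ j + e"
      using dist[of j "max j N"] N[of "max j N"] by simp
    finally show "mdist m (s j) y \<le> 4 * (1/2) ^ j + e" .
  qed
qed

text \<open>\<open>\<phi> y\<close> codes the bits \<open>dist (d n) y < 2 ^ -j\<close>. The map \<open>\<psi>\<close> reads off the least \<open>n\<close> for each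
  \<open>j\<close> and takes the limit of the resulting sequence; since the sequence converges at a known rate,
  membership of the limit in an open set is decided by a single term, whence \<open>\<psi>\<close> is measurable.\<close>

lemma borel_of_metric_real_retract:
  assumes m: "mcomplete_of m" and d: "\<And>n. d n \<in> mspace m"
    and dense: "\<And>y e. y \<in> mspace m \<Longrightarrow> e > 0 \<Longrightarrow> \<exists>n::nat. mdist m (d n) y < e"
  obtains \<phi> :: "'b \<Rightarrow> real" and \<psi> where "\<phi> \<in> borel_measurable (borel_of_metric m)"
    "\<psi> \<in> borel \<rightarrow>\<^sub>M borel_of_metric m" "\<And>y. \<phi> y \<in> {0..1}" "\<And>y. y \<in> mspace m \<Longrightarrow> \<psi> (\<phi> y) = y"
proof -
  interpret Metric_space "mspace m" "mdist m" by (rule Metric_space_mspace_mdist)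
  define b where "b y i \<longleftrightarrow> (case prod_decode i of (n, j) \<Rightarrow> mdist m (d n) y < (1/2) ^ j)" for y i
  define \<phi> where "\<phi> y = binary_code (b y)" for y
  have b_meas: "Measurable.pred (borel_of_metric m) (\<lambda>y. b y i)" for i
  proof -
    obtain n j where nj: "prod_decode i = (n, j)" by fastforce
    have "{y \<in> space (borel_of_metric m). b y i} = mball_of m (d n) ((1/2) ^ j)"
      using d by (auto simp: b_def nj)
    then show ?thesis
      unfolding pred_def by (simp add: openin_borel_of_metric openin_mball_of)
  qed
  have \<phi>_meas: "\<phi> \<in> borel_measurable (borel_of_metric m)"
    unfolding \<phi>_def binary_code_def of_bool_def using b_meas by measurable
  \<comment> \<open>If no bit for \<open>j\<close> is set, \<open>LEAST\<close> returns an
    unspecified index; \<open>s j x\<close> is still a point of the space, and only the test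
    \<open>fast\<close> decides whether the sequence is used.\<close>
  define N where "N j x = (LEAST n. binary_digit (prod_encode (n, j)) x)" for j x
  define s where "s j x = d (N j x)" for j x
  \<comment> \<open>\<open>s j\<close> factors through the countable index \<open>N j\<close>, so
    any predicate whatsoever of \<open>s j x\<close> is Borel in \<open>x\<close>.\<close>
  have s_pred: "Measurable.pred borel (\<lambda>x. P (s j x))" for P j
  proof -
    have "N j \<in> borel \<rightarrow>\<^sub>M count_space UNIV" unfolding N_def by measurable
    then show ?thesis unfolding s_def by (rule measurable_compose) simp
  qed
  have s_dist: "Measurable.pred borel (\<lambda>x. mdist m (s j x) (s k x) \<le> c)" for j k c
  proof -
    have [measurable]: "N j \<in> borel \<rightarrow>\<^sub>M count_space UNIV" for j unfolding N_def by measurable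
    have "(\<lambda>x. mdist m (s j x) (s k x) \<le> c)
        = (\<lambda>x. \<exists>p q. N j x = p \<and> N k x = q \<and> mdist m (d p) (d q) \<le> c)"
      by (auto simp: s_def)
    also have "Measurable.pred borel \<dots>" by measurable
    finally show ?thesis .
  qed
  have sM: "s j x \<in> mspace m" for j x by (simp add: s_def d)
  define fast where "fast x \<longleftrightarrow> (\<forall>j. mdist m (s j x) (s (Suc j) x) \<le> 2 * (1/2) ^ j)" for x
  have fast_meas: "Measurable.pred borel (\<lambda>x. fast x)"
    unfolding fast_def
  proof (rule pred_intros_countable(1))
    show "Measurable.pred borel (\<lambda>x. mdist m (s j x) (s (Suc j) x) \<le> 2 * (1/2) ^ j)" for j
      by (rule s_dist)
  qed
  define L where "L x y \<longleftrightarrow> y \<in> mspace m \<and> (\<forall>j. mdist m (s j x) y \<le> 4 * (1/2) ^ j)" for x y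
  \<comment> \<open>At most one \<open>y\<close> satisfies \<open>L x y\<close>, so
    \<open>SOME\<close> names the limit; \<open>d 0\<close> is a default for codes that fail the
    test.\<close>
  define \<psi> where "\<psi> x = (if fast x then SOME y. L x y else d 0)" for x
  have \<psi>_fast: "L x (\<psi> x)" if x: "fast x" for x
  proof -
    have step: "mdist m (s j x) (s (Suc j) x) \<le> 2 * (1/2) ^ j" for j
      using x by (simp add: fast_def)
    obtain y where "y \<in> mspace m" "\<And>j. mdist m (s j x) y \<le> 4 * (1/2) ^ j"
      by (rule mcomplete_of_fast_limit[OF m, of "\<lambda>j. s j x"]) (use sM step in auto)
    then have "L x y" by (simp add: L_def)
    then have "L x (SOME y. L x y)" by (rule someI)
    then show ?thesis using x by (simp add: \<psi>_def)
  qed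
  have \<psi>_space: "\<psi> x \<in> mspace m" for x
    using \<psi>_fast[of x] d by (cases "fast x") (auto simp: L_def \<psi>_def)
  \<comment> \<open>A closed ball of radius \<open>4 * (1/2) ^ j\<close> has diameter at most twice
    that, whence the 8: containing the point \<open>\<psi> x\<close>, it fits into a given ball
    around it for large \<open>j\<close>.\<close>
  have small: "\<exists>N. 8 * (1/2 :: real) ^ N < e" if "e > 0" for e
    using real_arch_pow_inv[of "e / 8" "1/2"] that by (auto simp: mult.commute)
  have \<psi>_meas: "\<psi> \<in> borel \<rightarrow>\<^sub>M borel_of_metric m"
  proof (rule measurable_borel_of_metricI)
    fix U assume U: "openin (mtopology_of m) U"
    have mem: "\<psi> x \<in> U \<longleftrightarrow> (\<exists>j. mcball_of m (s j x) (4 * (1/2) ^ j) \<subseteq> U)" if x: "fast x" for x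
    proof
      assume "\<psi> x \<in> U"
      then obtain e where e: "e > 0" "mball_of m (\<psi> x) e \<subseteq> U"
        using U unfolding openin_mtopology_of_iff by blast
      obtain j where j: "8 * (1/2 :: real) ^ j < e" using small e(1) by blast
      have "mcball_of m (s j x) (4 * (1/2) ^ j) \<subseteq> mball_of m (\<psi> x) e"
      proof
        fix z assume z: "z \<in> mcball_of m (s j x) (4 * (1/2) ^ j)"
        have "mdist m (\<psi> x) z \<le> mdist m (\<psi> x) (s j x) + mdist m (s j x) z"
          using triangle z \<psi>_space sM by auto
        also have "\<dots> \<le> 4 * (1/2) ^ j + 4 * (1/2) ^ j"
          using z \<psi>_fast[OF x] commute[of "\<psi> x" "s j x"] by (intro add_mono) (auto simp: L_def)
        finally show "z \<in> mball_of m (\<psi> x) e" using j z \<psi>_space by simp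
      qed
      then show "\<exists>j. mcball_of m (s j x) (4 * (1/2) ^ j) \<subseteq> U" using e(2) by blast
    next
      assume "\<exists>j. mcball_of m (s j x) (4 * (1/2) ^ j) \<subseteq> U"
      then obtain j where "mcball_of m (s j x) (4 * (1/2) ^ j) \<subseteq> U" by blast
      moreover have "\<psi> x \<in> mcball_of m (s j x) (4 * (1/2) ^ j)"
        using \<psi>_fast[OF x] sM by (simp add: L_def)
      ultimately show "\<psi> x \<in> U" by blast
    qed
    have eq: "\<psi> -` U \<inter> space borel =
        {x \<in> space borel. (fast x \<and> (\<exists>j. mcball_of m (s j x) (4 * (1/2) ^ j) \<subseteq> U)) \<or> (\<not> fast x \<and> d 0 \<in> U)}"
    proof (rule set_eqI)
      fix x
      have "\<psi> x = d 0" if "\<not> fast x" using that by (simp add: \<psi>_def)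
      with mem[of x] show "x \<in> \<psi> -` U \<inter> space borel \<longleftrightarrow> x \<in>
        {x \<in> space borel. (fast x \<and> (\<exists>j. mcball_of m (s j x) (4 * (1/2) ^ j) \<subseteq> U)) \<or> (\<not> fast x \<and> d 0 \<in> U)}"
        by (cases "fast x") simp_all
    qed
    have s_ball: "Measurable.pred borel (\<lambda>x. mcball_of m (s j x) (4 * (1/2) ^ j) \<subseteq> U)" for j
      by (rule s_pred)
    have "Measurable.pred borel (\<lambda>x. d 0 \<in> U)" by simp
    then show "\<psi> -` U \<inter> space borel \<in> sets borel"
      unfolding eq by (intro predE pred_intros_logic pred_intros_countable fast_meas s_ball)
  qed (rule \<psi>_space)
  have inv: "\<psi> (\<phi> y) = y" if y: "y \<in> mspace m" for y
  proof -
    have close: "mdist m (s j (\<phi> y)) y < (1/2) ^ j" for j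
    proof -
      have dig: "binary_digit (prod_encode (n, j)) (\<phi> y) \<longleftrightarrow> mdist m (d n) y < (1/2) ^ j" for n
        by (simp add: \<phi>_def binary_digit_code b_def)
      obtain n where "mdist m (d n) y < (1/2) ^ j" using dense[OF y, of "(1/2) ^ j"] by auto
      then show ?thesis unfolding s_def N_def dig by (rule LeastI)
    qed
    have "fast (\<phi> y)"
      unfolding fast_def
    proof
      fix j
      have "mdist m (s j (\<phi> y)) (s (Suc j) (\<phi> y)) \<le> mdist m (s j (\<phi> y)) y + mdist m y (s (Suc j) (\<phi> y))"
        using triangle sM y by blast
      also have "\<dots> \<le> (1/2) ^ j + (1/2) ^ Suc j"
        using close[of j] close[of "Suc j"] commute[of y "s (Suc j) (\<phi> y)"] by linarith
      also have "\<dots> \<le> 2 * (1/2) ^ j" by simp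
      finally show "mdist m (s j (\<phi> y)) (s (Suc j) (\<phi> y)) \<le> 2 * (1/2) ^ j" .
    qed
    then have L: "L (\<phi> y) (\<psi> (\<phi> y))" by (rule \<psi>_fast)
    have "mdist m (\<psi> (\<phi> y)) y \<le> e" if "e > 0" for e
    proof -
      obtain j where j: "8 * (1/2 :: real) ^ j < e" using small \<open>e > 0\<close> by blast
      have "mdist m (\<psi> (\<phi> y)) y \<le> mdist m (\<psi> (\<phi> y)) (s j (\<phi> y)) + mdist m (s j (\<phi> y)) y"
        using triangle \<psi>_space sM y by blast
      also have "\<dots> \<le> 4 * (1/2) ^ j + (1/2) ^ j"
        using L close[of j] commute[of "\<psi> (\<phi> y)" "s j (\<phi> y)"] by (intro add_mono) (auto simp: L_def)
      also have "\<dots> \<le> 8 * (1/2) ^ j" by simp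
      finally show ?thesis using j by simp
    qed
    then have "mdist m (\<psi> (\<phi> y)) y \<le> 0" by (rule field_le_epsilon[of _ 0, simplified])
    then show ?thesis using \<psi>_space y nonneg[of "\<psi> (\<phi> y)" y] zero[of "\<psi> (\<phi> y)" y] by auto
  qed
  show thesis
  proof (rule that[OF \<phi>_meas \<psi>_meas _ inv])
    show "\<phi> y \<in> {0..1}" for y
      using binary_code_bounds[of "b y"] by (simp add: \<phi>_def)
  qed
qed

text \<open>On the line, kernels come from distribution functions. The real code of \<open>Y\<close>
  is therefore conditioned first, and the kernel is then decoded by \<open>\<psi>\<close>.\<close>

theorem (in prob_space) ex_regular_cond_law:
  assumes m: "mcomplete_of m" and d: "\<And>n. d n \<in> mspace m"
    and dense: "\<And>y e. y \<in> mspace m \<Longrightarrow> e > 0 \<Longrightarrow> \<exists>n::nat. mdist m (d n) y < e"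
    and G: "subalgebra M G" and Y: "Y \<in> M \<rightarrow>\<^sub>M borel_of_metric m"
  obtains \<kappa> where "regular_cond_law M G (borel_of_metric m) Y \<kappa>"
proof -
  obtain \<phi> :: "'b \<Rightarrow> real" and \<psi> where \<phi>: "\<phi> \<in> borel_measurable (borel_of_metric m)"
    and \<psi>: "\<psi> \<in> borel \<rightarrow>\<^sub>M borel_of_metric m" and \<phi>01: "\<And>y. \<phi> y \<in> {0..1}"
    and inv: "\<And>y. y \<in> mspace m \<Longrightarrow> \<psi> (\<phi> y) = y"
    by (rule borel_of_metric_real_retract[OF m d dense]; (assumption | rule that)?)
  have "(\<lambda>\<omega>. \<phi> (Y \<omega>)) \<in> borel_measurable M"
    by (rule measurable_compose[OF Y \<phi>])
  then obtain \<kappa> where \<kappa>: "regular_cond_law M G borel (\<lambda>\<omega>. \<phi> (Y \<omega>)) \<kappa>"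
    using ex_regular_cond_law_unit_interval[OF G] \<phi>01 by blast
  have "regular_cond_law M G (borel_of_metric m) Y (\<lambda>\<omega>. distr (\<kappa> \<omega>) (borel_of_metric m) \<psi>)"
    using measurable_space[OF Y] by (intro regular_cond_law_transfer[OF \<kappa> \<psi>]) (simp add: inv)
  then show thesis by (rule that)
qed

subsection \<open>The space of continuous paths\<close>

lemma mspace_path_space:
  "f \<in> mspace (path_space UNIV u v) \<longleftrightarrow> f \<in> extensional {u..v} \<and> continuous_on {u..v} f"
proof -
  have "compactin (top_of_set {u..v}) (topspace (top_of_set {u..v}))"
    by (simp add: compactin_subtopology)
  from compactin_mspace_cfunspace[OF this, of euclidean_metric] show ?thesis
    by (auto simp: path_space_def)
qed

lemma restrict_in_path_space:
  "continuous_on {u..v} f \<Longrightarrow> (\<lambda>s\<in>{u..v}. f s) \<in> mspace (path_space UNIV u v)"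
  by (auto simp: mspace_path_space intro: continuous_on_eq)

lemma mdist_path_space_le:
  assumes "u \<le> v" "f \<in> mspace (path_space UNIV u v)" "g \<in> mspace (path_space UNIV u v)"
  shows "mdist (path_space UNIV u v) f g \<le> a \<longleftrightarrow> (\<forall>s\<in>{u..v}. \<bar>f s - g s\<bar> \<le> a)"
  using cfunspace_mdist_le[of f "top_of_set {u..v}" euclidean_metric g a] assms
  by (simp add: path_space_def dist_real_def)

lemma path_space_eval_le:
  assumes "f \<in> mspace (path_space UNIV u v)" "g \<in> mspace (path_space UNIV u v)" "s \<in> {u..v}"
  shows "\<bar>f s - g s\<bar> \<le> mdist (path_space UNIV u v) f g"
  using mdist_path_space_le[of u v f g "mdist (path_space UNIV u v) f g"] assms by auto

lemma mcomplete_path_space: "mcomplete_of (path_space UNIV u v)"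
proof -
  have "Met_TC.mcomplete TYPE(real)" by (simp add: complete_UNIV)
  from Met_TC.mcomplete_cfunspace[OF this, of "top_of_set {u..v}"] show ?thesis
    by (simp add: path_space_def Met_TC.Self_def euclidean_metric_def[symmetric])
qed

text \<open>Bernstein polynomials with rational coefficients are indexed by degree and coefficient
  list, hence countable. The Bernstein basis is nonnegative with sum 1, so rounding each coefficient
  by less than \<open>e / 4\<close> moves the polynomial uniformly by at most \<open>e / 4\<close>;
  the approximation of \<open>f\<close> costs another \<open>e / 4\<close>.\<close>

lemma path_space_dense_sequence:
  assumes uv: "u < v"
  obtains d :: "nat \<Rightarrow> real \<Rightarrow> real" where "\<And>n. d n \<in> mspace (path_space UNIV u v)"
    "\<And>f e. f \<in> mspace (path_space UNIV u v) \<Longrightarrow> e > 0 \<Longrightarrow> \<exists>n. mdist (path_space UNIV u v) (d n) f < e"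
proof -
  define P where "P n q = (\<lambda>s\<in>{u..v}. \<Sum>k\<le>n. real_of_rat (q ! k) * Bernstein n k ((s - u) / (v - u)))"
    for n and q :: "rat list"
  define d where "d i = (case from_nat i of (n, q) \<Rightarrow> P n q)" for i
  have P: "P n q \<in> mspace (path_space UNIV u v)" for n q
    unfolding P_def Bernstein_def using uv
    by (intro restrict_in_path_space continuous_intros) auto
  show thesis
  proof (rule that)
    show "d n \<in> mspace (path_space UNIV u v)" for n
      using P by (simp add: d_def split: prod.split)
  next
    fix f :: "real \<Rightarrow> real" and e :: real assume f: "f \<in> mspace (path_space UNIV u v)" and e: "e > 0"
    define g where "g x = f (u + x * (v - u))" for x
    have ran: "u + x * (v - u) \<in> {u..v}" if x: "x \<in> {0..1}" for x
    proof -
      have "x * (v - u) \<le> 1 * (v - u)" using x uv by (intro mult_right_mono) auto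
      moreover have "0 \<le> x * (v - u)" using x uv by simp
      ultimately show ?thesis by auto
    qed
    have "continuous_on {u..v} f" using f mspace_path_space by blast
    then have "continuous_on {0..1} (\<lambda>x. f (u + x * (v - u)))"
      by (rule continuous_on_compose2) (use ran in \<open>auto intro!: continuous_intros\<close>)
    then have g: "continuous_on {0..1} g" by (simp add: g_def[abs_def])
    have "0 < e / 4" using e by simp
    from Bernstein_Weierstrass[OF g this] obtain n where
      "\<forall>n' x. n \<le> n' \<and> x \<in> {0..1} \<longrightarrow> \<bar>g x - (\<Sum>k\<le>n'. g (k/n') * Bernstein n' k x)\<bar> < e / 4" ..
    then have n: "\<bar>g x - (\<Sum>k\<le>n. g (k/n) * Bernstein n k x)\<bar> < e / 4" if "x \<in> {0..1}" for x
      using that by simp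
    have "\<exists>r. \<bar>real_of_rat r - g (k/n)\<bar> < e / 4" for k :: nat
    proof -
      have "g (k/n) - e/4 < g (k/n) + e/4" using e by simp
      then obtain x where x: "x \<in> \<rat>" "g (k/n) - e/4 < x" "x < g (k/n) + e/4"
        using Rats_dense_in_real by blast
      obtain r where "x = real_of_rat r" using x(1) by (rule Rats_cases)
      with x show ?thesis by (intro exI[of _ r]) linarith
    qed
    then obtain r where r: "\<And>k::nat. \<bar>real_of_rat (r k) - g (k/n)\<bar> < e / 4" by metis
    define q where "q = map r [0..<Suc n]"
    have q: "q ! k = r k" if "k \<le> n" for k using that by (simp add: q_def del: upt_Suc)
    have "\<bar>P n q s - f s\<bar> \<le> e / 2" if s: "s \<in> {u..v}" for s
    proof -
      define x where "x = (s - u) / (v - u)"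
      have x: "x \<in> {0..1}" using s uv by (auto simp: x_def)
      have "g x = f s" using uv by (simp add: g_def x_def)
      have "P n q s = (\<Sum>k\<le>n. real_of_rat (r k) * Bernstein n k x)"
        using s by (simp add: P_def x_def q)
      then have "\<bar>P n q s - (\<Sum>k\<le>n. g (k/n) * Bernstein n k x)\<bar>
          = \<bar>\<Sum>k\<le>n. (real_of_rat (r k) - g (k/n)) * Bernstein n k x\<bar>"
        by (simp add: sum_subtractf left_diff_distrib)
      also have "\<dots> \<le> (\<Sum>k\<le>n. e / 4 * Bernstein n k x)"
      proof (rule order_trans[OF sum_abs], rule sum_mono)
        fix k
        show "\<bar>(real_of_rat (r k) - g (k/n)) * Bernstein n k x\<bar> \<le> e / 4 * Bernstein n k x"
          unfolding abs_mult using r[of k] Bernstein_nonneg[of x n k] x e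
          by (intro mult_mono) auto
      qed
      also have "\<dots> = e / 4" unfolding sum_distrib_left[symmetric] by simp
      finally show ?thesis using n[OF x] \<open>g x = f s\<close> by linarith
    qed
    then have "mdist (path_space UNIV u v) (P n q) f \<le> e / 2"
      using mdist_path_space_le[OF less_imp_le[OF uv] P f] by blast
    then have "mdist (path_space UNIV u v) (d (to_nat (n, q))) f < e"
      using e by (simp add: d_def)
    then show "\<exists>n. mdist (path_space UNIV u v) (d n) f < e" by blast
  qed
qed

section \<open>Evaluation maps and measurability of path-valued maps\<close>

lemma openin_path_space_eval:
  assumes V: "open V" and s: "s \<in> {u..v}"
  shows "openin (mtopology_of (path_space UNIV u v)) {f \<in> mspace (path_space UNIV u v). f s \<in> V}"
  unfolding openin_mtopology_of_iff
proof (intro conjI ballI)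
  fix f assume f: "f \<in> {f \<in> mspace (path_space UNIV u v). f s \<in> V}"
  then obtain e where e: "e > 0" "ball (f s) e \<subseteq> V" using V open_contains_ball by blast
  have "mball_of (path_space UNIV u v) f e \<subseteq> {f \<in> mspace (path_space UNIV u v). f s \<in> V}"
  proof
    fix g assume g: "g \<in> mball_of (path_space UNIV u v) f e"
    then have "\<bar>f s - g s\<bar> < e" using path_space_eval_le[of f u v g s] s by auto
    then show "g \<in> {f \<in> mspace (path_space UNIV u v). f s \<in> V}"
      using g e(2) by (auto simp: subset_iff dist_real_def)
  qed
  with e(1) show "\<exists>r>0. mball_of (path_space UNIV u v) f r \<subseteq> {f \<in> mspace (path_space UNIV u v). f s \<in> V}"
    by blast
qed auto

lemma closedin_path_space_eval:
  assumes V: "closed V" and s: "s \<in> {u..v}"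
  shows "closedin (mtopology_of (path_space UNIV u v)) {f \<in> mspace (path_space UNIV u v). f s \<in> V}"
proof -
  have "mspace (path_space UNIV u v) - {f \<in> mspace (path_space UNIV u v). f s \<in> V}
      = {f \<in> mspace (path_space UNIV u v). f s \<in> - V}" by auto
  then show ?thesis
    using openin_path_space_eval[of "- V" s u v] V s by (auto simp: closedin_def)
qed

text \<open>Continuity reduces the quantifier to a countable dense set of times. The inequality is
  nonstrict so that it passes from that set to its closure.\<close>

lemma sets_all_le_continuous:
  fixes g :: "real \<Rightarrow> 'a \<Rightarrow> real"
  assumes meas: "\<And>s. s \<in> {u..v} \<Longrightarrow> g s \<in> borel_measurable M"
    and cont: "\<And>\<omega>. \<omega> \<in> space M \<Longrightarrow> continuous_on {u..v} (\<lambda>s. g s \<omega>)"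
  shows "{\<omega> \<in> space M. \<forall>s\<in>{u..v}. g s \<omega> \<le> c} \<in> sets M"
proof -
  obtain D where D: "countable D" "D \<subseteq> {u..v}" "{u..v} \<subseteq> closure D"
    using separable[of "{u..v}"] by blast
  have cl: "closure D = {u..v}" using D closure_minimal[of D "{u..v}"] by auto
  have "{\<omega> \<in> space M. \<forall>s\<in>{u..v}. g s \<omega> \<le> c} = {\<omega> \<in> space M. \<forall>s\<in>D. g s \<omega> \<le> c}"
    using D(2) cont continuous_le_on_closure[of D] unfolding cl by blast
  also have "\<dots> = space M - (\<Union>s\<in>D. {\<omega> \<in> space M. \<not> g s \<omega> \<le> c})" by blast
  also have "\<dots> \<in> sets M"
  proof (intro sets.Diff sets.top sets.countable_UN''[OF D(1)])
    fix s assume "s \<in> D"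
    then have [measurable]: "g s \<in> borel_measurable M" using D(2) meas by blast
    show "{\<omega> \<in> space M. \<not> g s \<omega> \<le> c} \<in> sets M" by measurable
  qed
  finally show ?thesis .
qed

lemma sets_all_abs_le_continuous:
  fixes g :: "real \<Rightarrow> 'a \<Rightarrow> real"
  assumes meas: "\<And>s. s \<in> {u..v} \<Longrightarrow> g s \<in> borel_measurable M"
    and cont: "\<And>\<omega>. \<omega> \<in> space M \<Longrightarrow> continuous_on {u..v} (\<lambda>s. g s \<omega>)"
  shows "{\<omega> \<in> space M. \<forall>s\<in>{u..v}. \<bar>g s \<omega>\<bar> \<le> c} \<in> sets M"
  by (rule sets_all_le_continuous[where g="\<lambda>s \<omega>. \<bar>g s \<omega>\<bar>"])
    (auto intro!: borel_measurable_abs continuous_intros meas cont)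

text \<open>By separability an open set of paths is a countable union of closed balls around the
  dense sequence, so it suffices to pull back closed balls. Those are bounds on a supremum of
  continuous paths, covered by \<open>sets_all_abs_le_continuous\<close>.\<close>

lemma measurable_path:
  assumes uv: "u < v" and meas: "\<And>s. s \<in> {u..v} \<Longrightarrow> Y s \<in> borel_measurable M"
    and cont: "\<And>\<omega>. \<omega> \<in> space M \<Longrightarrow> continuous_on {u..v} (\<lambda>s. Y s \<omega>)"
  shows "(\<lambda>\<omega>. \<lambda>s\<in>{u..v}. Y s \<omega>) \<in> M \<rightarrow>\<^sub>M borel_of_metric (path_space UNIV u v)"
proof (rule measurable_borel_of_metricI)
  let ?m = "path_space UNIV u v" and ?Y = "\<lambda>\<omega>. \<lambda>s\<in>{u..v}. Y s \<omega>"
  interpret Metric_space "mspace ?m" "mdist ?m" by (rule Metric_space_mspace_mdist)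
  show sp: "?Y \<omega> \<in> mspace ?m" if "\<omega> \<in> space M" for \<omega>
    by (rule restrict_in_path_space[OF cont[OF that]])
  fix U assume U: "openin (mtopology_of ?m) U"
  obtain d :: "nat \<Rightarrow> real \<Rightarrow> real" where d: "\<And>n. d n \<in> mspace ?m"
    and dense: "\<And>f e. f \<in> mspace ?m \<Longrightarrow> e > 0 \<Longrightarrow> \<exists>n. mdist ?m (d n) f < e"
    using path_space_dense_sequence[OF uv] by blast
  define J where "J = {(n, k). mcball_of ?m (d n) (1 / Suc k) \<subseteq> U}"
  have ball: "?Y -` mcball_of ?m (d n) c \<inter> space M \<in> sets M" for n c
  proof -
    have dcont: "continuous_on {u..v} (d n)" using d mspace_path_space by blast
    have "?Y -` mcball_of ?m (d n) c \<inter> space M = {\<omega> \<in> space M. \<forall>s\<in>{u..v}. \<bar>Y s \<omega> - d n s\<bar> \<le> c}"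
      using d sp uv by (auto simp: mdist_path_space_le abs_minus_commute)
    also have "\<dots> \<in> sets M"
      by (rule sets_all_abs_le_continuous) (auto intro!: borel_measurable_diff continuous_intros meas cont dcont)
    finally show ?thesis .
  qed
  have "?Y -` U \<inter> space M = (\<Union>(n, k)\<in>J. ?Y -` mcball_of ?m (d n) (1 / Suc k) \<inter> space M)"
  proof (intro equalityI subsetI)
    fix \<omega> assume \<omega>: "\<omega> \<in> ?Y -` U \<inter> space M"
    let ?y = "?Y \<omega>"
    have y: "?y \<in> U" "?y \<in> mspace ?m" using \<omega> sp by auto
    obtain e where e: "e > 0" "mball_of ?m ?y e \<subseteq> U"
      using U y(1) unfolding openin_mtopology_of_iff by blast
    obtain k where k: "1 / Suc k < e / 2" using nat_approx_posE[of "e / 2"] e(1) by auto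
    obtain n where n: "mdist ?m (d n) ?y < 1 / Suc k" using dense[OF y(2)] by (metis of_nat_0_less_iff zero_less_Suc zero_less_divide_1_iff)
    have "mcball_of ?m (d n) (1 / Suc k) \<subseteq> U"
    proof (rule order_trans[OF subsetI e(2)])
      fix z assume z: "z \<in> mcball_of ?m (d n) (1 / Suc k)"
      then have "mdist ?m ?y z \<le> mdist ?m (d n) ?y + mdist ?m (d n) z"
        using triangle[of ?y "d n" z] y(2) commute[of ?y "d n"] by auto
      with z n k y(2) show "z \<in> mball_of ?m ?y e" by auto
    qed
    then show "\<omega> \<in> (\<Union>(n, k)\<in>J. ?Y -` mcball_of ?m (d n) (1 / Suc k) \<inter> space M)"
      using n d y(2) \<omega> by (intro UN_I[of "(n, k)"]) (auto simp: J_def)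
  qed (auto simp: J_def)
  also have "\<dots> \<in> sets M"
    by (rule sets.countable_UN'') (use ball in auto)
  finally show "?Y -` U \<inter> space M \<in> sets M" .
qed

subsection \<open>Conditional full support and small balls\<close>

text \<open>Positivity on every event of \<open>F t\<close> expresses that the conditional
  probability of the ball given \<open>F t\<close> is almost surely positive, without a choice of
  version. Subtracting \<open>Y t\<close> lets one target \<open>x\<close> serve all starting
  values. Closed balls do no harm, as \<open>\<delta>\<close> is arbitrary, and make the event
  measurable through countably many times.\<close>

definition small_ball_property ::
  "'a measure \<Rightarrow> real \<Rightarrow> (real \<Rightarrow> 'a measure) \<Rightarrow> (real \<Rightarrow> 'a \<Rightarrow> real) \<Rightarrow> bool" where
  "small_ball_property M T F Y \<longleftrightarrow>
     (\<forall>t\<in>{0..<T}. \<forall>A\<in>sets (F t). \<forall>x \<delta>.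
        emeasure M A > 0 \<longrightarrow> continuous_on {t..T} x \<longrightarrow> x t = 0 \<longrightarrow> \<delta> > 0 \<longrightarrow>
        emeasure M (A \<inter> {\<omega> \<in> space M. \<forall>u\<in>{t..T}. \<bar>Y u \<omega> - Y t \<omega> - x u\<bar> \<le> \<delta>}) > 0)"

lemma emeasure_pos_mono:
  "0 < emeasure M A \<Longrightarrow> A \<subseteq> B \<Longrightarrow> B \<in> sets M \<Longrightarrow> 0 < emeasure M B"
  by (rule order.strict_trans2[OF _ emeasure_mono])

lemma emeasure_UN_posD:
  fixes A :: "'i::countable \<Rightarrow> 'a set"
  assumes "emeasure M (\<Union>i. A i) > 0" "\<And>i. A i \<in> sets M"
  obtains i where "emeasure M (A i) > 0"
proof -
  have "\<exists>i. emeasure M (A i) > 0"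
  proof (rule ccontr)
    assume "\<not> ?thesis"
    then have "A i \<in> null_sets M" for i using assms(2) by (auto simp: null_sets_def)
    then have "(\<Union>i. A i) \<in> null_sets M" by (rule null_sets_UN)
    then show False using assms(1) by auto
  qed
  with that show thesis by blast
qed

lemma AE_indicator_nn_integral_0:
  assumes f: "f \<in> borel_measurable M" and A: "A \<in> sets M"
    and int: "(\<integral>\<^sup>+\<omega>. f \<omega> * indicator A \<omega> \<partial>M) = 0"
  shows "AE \<omega> in M. \<omega> \<in> A \<longrightarrow> f \<omega> = 0"
proof -
  have "AE \<omega> in M. f \<omega> * indicator A \<omega> = 0"
    using int f A by (subst (asm) nn_integral_0_iff_AE) auto
  then show ?thesis by eventually_elim (auto simp: indicator_def)
qed

lemma (in prob_space) regular_cond_law_integral: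
  assumes "regular_cond_law M G N Y \<kappa>" "B \<in> sets N" "A \<in> sets G"
  shows "(\<integral>\<^sup>+\<omega>. emeasure (\<kappa> \<omega>) B * indicator A \<omega> \<partial>M) = emeasure M (A \<inter> (Y -` B \<inter> space M))"
  using assms by (simp add: regular_cond_law_iff)

text \<open>The target path \<open>x + X t \<omega>\<close> moves with \<omega>, whereas the kernel
  is to be evaluated at a fixed set. Cutting \<open>A\<close> according to rationals
  \<open>q\<close> near \<open>X t\<close> leaves a piece of positive probability on which one ball
  \<open>B\<close> around \<open>x + q\<close> contains all targets. A ball meeting the support has
  positive mass, since otherwise its complement would be closed of measure one; integration over the
  piece concludes.\<close>

lemma has_CFS_imp_small_ball:
  assumes M: "prob_space M" and cfs: "has_CFS M T UNIV F X"
  shows "small_ball_property M T F X"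
  unfolding small_ball_property_def
proof (intro ballI allI impI)
  interpret prob_space M by (rule M)
  fix t A and x :: "real \<Rightarrow> real" and \<delta> :: real
  assume t: "t \<in> {0..<T}" and A: "A \<in> sets (F t)" and A_pos: "emeasure M A > 0"
    and x: "continuous_on {t..T} x" "x t = 0" and \<delta>: "\<delta> > 0"
  let ?m = "path_space UNIV t T" and ?X = "\<lambda>\<omega>. \<lambda>u\<in>{t..T}. X u \<omega>"
  have tT: "t \<le> T" "t \<in> {0..T}" using t by auto
  obtain \<kappa> where \<kappa>: "regular_cond_law M (F t) (borel_of_metric ?m) ?X \<kappa>"
    and supp: "AE \<omega> in M. is_support ?m (\<kappa> \<omega>) (paths_from UNIV t T (X t \<omega>))"
    using cfs t unfolding has_CFS_def by blast
  have F: "subalgebra M (F t)" and \<kappa>_meas: "\<kappa> \<in> F t \<rightarrow>\<^sub>M prob_algebra (borel_of_metric ?m)"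
    using \<kappa> by (auto simp: regular_cond_law_def)
  have FM: "B \<in> sets M" if "B \<in> sets (F t)" for B using that F by (auto simp: subalgebra_def)
  have Xt[measurable]: "X t \<in> borel_measurable (F t)" using cfs tT unfolding has_CFS_def by blast
  \<comment> \<open>An error below \<open>\<delta> / 3\<close> in the starting value keeps the
    target inside the ball of radius \<open>\<delta> / 2\<close>, and the two errors together stay
    below \<open>\<delta>\<close>.\<close>
  define Aq where "Aq q = A \<inter> {\<omega> \<in> space (F t). \<bar>X t \<omega> - real_of_rat q\<bar> < \<delta> / 3}" for q
  have Aq: "Aq q \<in> sets (F t)" for q using A unfolding Aq_def by measurable
  have "A = (\<Union>q. Aq q)"
  proof (intro equalityI subsetI)
    fix \<omega> assume \<omega>: "\<omega> \<in> A"
    obtain r where r: "r \<in> \<rat>" "X t \<omega> - \<delta> / 3 < r" "r < X t \<omega> + \<delta> / 3"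
      using Rats_dense_in_real[of "X t \<omega> - \<delta> / 3" "X t \<omega> + \<delta> / 3"] \<delta> by auto
    obtain q where "r = real_of_rat q" using r(1) by (rule Rats_cases)
    then have "\<bar>X t \<omega> - real_of_rat q\<bar> < \<delta> / 3" using r by linarith
    then have "\<omega> \<in> Aq q" using \<omega> sets.sets_into_space[OF A] by (auto simp: Aq_def)
    then show "\<omega> \<in> (\<Union>q. Aq q)" by blast
  qed (auto simp: Aq_def)
  then obtain q where q: "emeasure M (Aq q) > 0"
    using emeasure_UN_posD[of M Aq] A_pos FM[OF Aq] by metis
  define c where "c = (\<lambda>u\<in>{t..T}. x u + real_of_rat q)"
  define B where "B = mball_of ?m c (\<delta> / 2)"
  have c: "c \<in> mspace ?m"
    unfolding c_def by (intro restrict_in_path_space continuous_intros x)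
  have B: "openin (mtopology_of ?m) B" unfolding B_def by (rule openin_mball_of)
  have B_sets: "B \<in> sets (borel_of_metric ?m)" by (rule openin_borel_of_metric[OF B])
  have pos: "AE \<omega> in M. \<omega> \<in> Aq q \<longrightarrow> emeasure (\<kappa> \<omega>) B \<noteq> 0"
    using supp
  proof (eventually_elim, intro impI notI)
    fix \<omega> assume s: "is_support ?m (\<kappa> \<omega>) (paths_from UNIV t T (X t \<omega>))"
      and \<omega>: "\<omega> \<in> Aq q" and 0: "emeasure (\<kappa> \<omega>) B = 0"
    have "\<omega> \<in> space (F t)" using \<omega> by (simp add: Aq_def)
    then have K: "prob_space (\<kappa> \<omega>)" "sets (\<kappa> \<omega>) = sets (borel_of_metric ?m)"
      using measurable_space[OF \<kappa>_meas] by (auto simp: space_prob_algebra)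
    then have "space (\<kappa> \<omega>) = mspace ?m" using sets_eq_imp_space_eq[OF K(2)] by simp
    then have "emeasure (\<kappa> \<omega>) (mspace ?m - B) = 1"
      using emeasure_compl[of B "\<kappa> \<omega>"] 0 K B_sets prob_space.emeasure_space_1[OF K(1)] by simp
    moreover have "closedin (mtopology_of ?m) (mspace ?m - B)"
      using B by (metis closedin_diff closedin_topspace topspace_mtopology_of)
    ultimately have sub: "paths_from UNIV t T (X t \<omega>) \<subseteq> mspace ?m - B"
      using s unfolding is_support_def by blast
    define f where "f = (\<lambda>u\<in>{t..T}. x u + X t \<omega>)"
    have f: "f \<in> mspace ?m"
      unfolding f_def by (intro restrict_in_path_space continuous_intros x)
    have "f t = X t \<omega>" using x tT by (simp add: f_def)
    with f sub have "f \<notin> B" by (auto simp: paths_from_def)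
    moreover have "mdist ?m c f \<le> \<delta> / 3"
      using \<omega> unfolding mdist_path_space_le[OF tT(1) c f]
      by (auto simp: c_def f_def Aq_def abs_minus_commute)
    ultimately show False using c f \<delta> by (simp add: B_def)
  qed
  have "0 < emeasure M (Aq q \<inter> (?X -` B \<inter> space M))"
  proof (rule ccontr)
    assume "\<not> ?thesis"
    then have "emeasure M (Aq q \<inter> (?X -` B \<inter> space M)) = 0" by simp
    then have "(\<integral>\<^sup>+\<omega>. emeasure (\<kappa> \<omega>) B * indicator (Aq q) \<omega> \<partial>M) = 0"
      unfolding regular_cond_law_integral[OF \<kappa> B_sets Aq] .
    moreover have "(\<lambda>\<omega>. emeasure (\<kappa> \<omega>) B) \<in> borel_measurable M"
      using measurable_from_subalg[OF F measurable_compose[OF measurable_prob_algebraD[OF \<kappa>_meas]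
          measurable_emeasure_subprob_algebra[OF B_sets]]] .
    ultimately have "AE \<omega> in M. \<omega> \<in> Aq q \<longrightarrow> emeasure (\<kappa> \<omega>) B = 0"
      using FM[OF Aq] by (intro AE_indicator_nn_integral_0)
    with pos have "AE \<omega> in M. \<omega> \<notin> Aq q" by eventually_elim blast
    then have "Aq q \<in> null_sets M"
      using AE_iff_null_sets[OF FM[OF Aq[of q]]] by simp
    then show False using q by auto
  qed
  moreover have "Aq q \<inter> (?X -` B \<inter> space M)
      \<subseteq> A \<inter> {\<omega> \<in> space M. \<forall>u\<in>{t..T}. \<bar>X u \<omega> - X t \<omega> - x u\<bar> \<le> \<delta>}"
  proof (intro subsetI IntI CollectI conjI ballI)
    fix \<omega> u assume \<omega>: "\<omega> \<in> Aq q \<inter> (?X -` B \<inter> space M)" and u: "u \<in> {t..T}"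
    then have "mdist ?m c (?X \<omega>) < \<delta> / 2" "?X \<omega> \<in> mspace ?m" by (auto simp: B_def)
    then have "\<bar>c u - ?X \<omega> u\<bar> < \<delta> / 2"
      using path_space_eval_le[OF c _ u] by (meson le_less_trans)
    then have "\<bar>x u + real_of_rat q - X u \<omega>\<bar> < \<delta> / 2" using u by (simp add: c_def)
    moreover have "\<bar>X t \<omega> - real_of_rat q\<bar> < \<delta> / 3" using \<omega> by (simp add: Aq_def)
    ultimately show "\<bar>X u \<omega> - X t \<omega> - x u\<bar> \<le> \<delta>" by linarith
  qed (auto simp: Aq_def)
  moreover have "A \<inter> {\<omega> \<in> space M. \<forall>u\<in>{t..T}. \<bar>X u \<omega> - X t \<omega> - x u\<bar> \<le> \<delta>} \<in> sets M"
  proof (intro sets.Int FM[OF A] sets_all_abs_le_continuous)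
    have cp: "continuous_process M T UNIV X" using cfs by (simp add: has_CFS_def)
    show "(\<lambda>\<omega>. X s \<omega> - X t \<omega> - x s) \<in> borel_measurable M" if "s \<in> {t..T}" for s
      using cp that t unfolding continuous_process_def by (intro borel_measurable_diff) auto
    show "continuous_on {t..T} (\<lambda>s. X s \<omega> - X t \<omega> - x s)" if "\<omega> \<in> space M" for \<omega>
      using cp that t unfolding continuous_process_def
      by (intro continuous_intros x) (auto intro: continuous_on_subset)
  qed
  ultimately show "emeasure M (A \<inter> {\<omega> \<in> space M. \<forall>u\<in>{t..T}. \<bar>X u \<omega> - X t \<omega> - x u\<bar> \<le> \<delta>}) > 0"
    by (rule emeasure_pos_mono)
qed

text \<open>\<open>Y t\<close> is known to \<open>G\<close>, so the kernel should live on paths with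
  that starting value. As this set of paths moves with \<omega>, it is reached through rational
  levels: the kernel gives no mass to the wrong side of each level, and countably many wrong sides
  cover all paths that start elsewhere.\<close>

lemma regular_cond_law_eval:
  assumes M: "prob_space M" and tT: "t < T"
    and \<kappa>: "regular_cond_law M G (borel_of_metric (path_space UNIV t T)) (\<lambda>\<omega>. \<lambda>u\<in>{t..T}. Y u \<omega>) \<kappa>"
    and Yt: "Y t \<in> borel_measurable G"
  shows "AE \<omega> in M. emeasure (\<kappa> \<omega>) (paths_from UNIV t T (Y t \<omega>)) = 1"
proof -
  interpret prob_space M by (rule M)
  let ?m = "path_space UNIV t T" and ?Y = "\<lambda>\<omega>. \<lambda>u\<in>{t..T}. Y u \<omega>"
  have G: "subalgebra M G" and \<kappa>_meas: "\<kappa> \<in> G \<rightarrow>\<^sub>M prob_algebra (borel_of_metric ?m)"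
    using \<kappa> by (auto simp: regular_cond_law_def)
  have GM: "B \<in> sets M" if "B \<in> sets G" for B using that G by (auto simp: subalgebra_def)
  have spG: "space G = space M" using G by (simp add: subalgebra_def)
  have t_in: "t \<in> {t..T}" using tT by simp
  have null: "AE \<omega> in M. Y t \<omega> \<in> - V \<longrightarrow> emeasure (\<kappa> \<omega>) {f \<in> mspace ?m. f t \<in> V} = 0"
    if V: "V \<in> sets borel" "{f \<in> mspace ?m. f t \<in> V} \<in> sets (borel_of_metric ?m)" for V
  proof -
    let ?B = "{f \<in> mspace ?m. f t \<in> V}" and ?A = "Y t -` (- V) \<inter> space G"
    have A: "?A \<in> sets G" using Yt V(1) by (intro measurable_sets) auto
    have "?A \<inter> (?Y -` ?B \<inter> space M) = {}" using t_in by auto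
    then have "(\<integral>\<^sup>+\<omega>. emeasure (\<kappa> \<omega>) ?B * indicator ?A \<omega> \<partial>M) = 0"
      unfolding regular_cond_law_integral[OF \<kappa> V(2) A] by simp
    moreover have "(\<lambda>\<omega>. emeasure (\<kappa> \<omega>) ?B) \<in> borel_measurable M"
      using measurable_from_subalg[OF G measurable_compose[OF measurable_prob_algebraD[OF \<kappa>_meas]
          measurable_emeasure_subprob_algebra[OF V(2)]]] .
    ultimately have "AE \<omega> in M. \<omega> \<in> ?A \<longrightarrow> emeasure (\<kappa> \<omega>) ?B = 0"
      using GM[OF A] by (intro AE_indicator_nn_integral_0)
    with AE_space show ?thesis by eventually_elim (auto simp: spG)
  qed
  have lt: "{f \<in> mspace ?m. f t \<in> {..<q}} \<in> sets (borel_of_metric ?m)"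
    and ge: "{f \<in> mspace ?m. f t \<in> {q..}} \<in> sets (borel_of_metric ?m)" for q :: real
    by (intro openin_borel_of_metric openin_path_space_eval t_in, simp)
      (intro closedin_borel_of_metric closedin_path_space_eval t_in, simp)
  have AE_lt: "AE \<omega> in M. \<forall>q\<in>\<rat>. Y t \<omega> \<in> - {..<q} \<longrightarrow> emeasure (\<kappa> \<omega>) {f \<in> mspace ?m. f t \<in> {..<q}} = 0"
    unfolding AE_ball_countable[OF countable_rat]
    by (rule ballI, rule null[OF _ lt]) simp
  have AE_ge: "AE \<omega> in M. \<forall>q\<in>\<rat>. Y t \<omega> \<in> - {q..} \<longrightarrow> emeasure (\<kappa> \<omega>) {f \<in> mspace ?m. f t \<in> {q..}} = 0"
    unfolding AE_ball_countable[OF countable_rat]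
    by (rule ballI, rule null[OF _ ge]) simp
  from AE_space AE_lt AE_ge show ?thesis
  proof eventually_elim
    case (elim \<omega>)
    then have K: "prob_space (\<kappa> \<omega>)" "sets (\<kappa> \<omega>) = sets (borel_of_metric ?m)"
      using measurable_space[OF \<kappa>_meas] by (auto simp: space_prob_algebra spG)
    have sp: "space (\<kappa> \<omega>) = mspace ?m" using sets_eq_imp_space_eq[OF K(2)] by simp
    let ?y = "Y t \<omega>"
    define N where "N q = (if q \<le> ?y then {f \<in> mspace ?m. f t \<in> {..<q}} else {f \<in> mspace ?m. f t \<in> {q..}})" for q
    have "N q \<in> null_sets (\<kappa> \<omega>)" if "q \<in> \<rat>" for q
      using elim that lt ge by (auto simp: N_def null_sets_def K(2))
    then have "(\<Union>q\<in>\<rat>. N q) \<in> null_sets (\<kappa> \<omega>)"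
      by (intro null_sets_UN' countable_rat)
    moreover have "mspace ?m - paths_from UNIV t T ?y = (\<Union>q\<in>\<rat>. N q)"
    proof (intro equalityI subsetI)
      fix f assume f: "f \<in> mspace ?m - paths_from UNIV t T ?y"
      then have "f t \<noteq> ?y" by (auto simp: paths_from_def)
      then consider "f t < ?y" | "?y < f t" by linarith
      then show "f \<in> (\<Union>q\<in>\<rat>. N q)"
      proof cases
        case 1
        then obtain q where "q \<in> \<rat>" "f t < q" "q < ?y" using Rats_dense_in_real by blast
        with f show ?thesis by (intro UN_I[of q]) (auto simp: N_def)
      next
        case 2
        then obtain q where "q \<in> \<rat>" "?y < q" "q < f t" using Rats_dense_in_real by blast
        with f show ?thesis by (intro UN_I[of q]) (auto simp: N_def)
      qed
    qed (auto simp: N_def paths_from_def split: if_splits)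
    ultimately have N: "mspace ?m - paths_from UNIV t T ?y \<in> null_sets (\<kappa> \<omega>)" by simp
    have "paths_from UNIV t T ?y = space (\<kappa> \<omega>) - (mspace ?m - paths_from UNIV t T ?y)"
      by (auto simp: sp paths_from_def)
    then show ?case
      using emeasure_Diff_null_set[OF N sets.top] prob_space.emeasure_space_1[OF K(1)] by simp
  qed
qed

text \<open>Balls with centre \<open>d n\<close> and radius \<open>1 / Suc k\<close> form a
  countable family, so off one null set the kernel charges each of them whose centre starts within
  the radius of \<open>Y t \<omega>\<close>. A closed set of full measure that missed a path from
  \<open>Y t \<omega>\<close> would leave such a ball in its complement.\<close>

lemma small_ball_imp_has_CFS:
  assumes M: "prob_space M" and Y: "continuous_process M T UNIV Y" and filt: "filtration_upto M T F"
    and adapted: "\<And>t. t \<in> {0..T} \<Longrightarrow> Y t \<in> borel_measurable (F t)"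
    and small: "small_ball_property M T F Y"
  shows "has_CFS M T UNIV F Y"
  unfolding has_CFS_def
proof (intro conjI ballI Y filt adapted)
  interpret prob_space M by (rule M)
  fix t assume t: "t \<in> {0..<T}"
  let ?m = "path_space UNIV t T" and ?Y = "\<lambda>\<omega>. \<lambda>u\<in>{t..T}. Y u \<omega>"
  interpret S: Metric_space "mspace ?m" "mdist ?m" by (rule Metric_space_mspace_mdist)
  have tT: "t < T" "t \<le> T" "t \<in> {0..T}" "t \<in> {t..T}" using t by auto
  have F: "subalgebra M (F t)" using filt tT by (simp add: filtration_upto_def)
  have FM: "B \<in> sets M" if "B \<in> sets (F t)" for B using that F by (auto simp: subalgebra_def)
  have spF: "space (F t) = space M" using F by (simp add: subalgebra_def)
  have Yt[measurable]: "Y t \<in> borel_measurable (F t)" using adapted tT by blast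
  have Y_meas: "?Y \<in> M \<rightarrow>\<^sub>M borel_of_metric ?m"
    using Y t unfolding continuous_process_def
    by (intro measurable_path[OF tT(1)]) (auto intro: continuous_on_subset)
  obtain d :: "nat \<Rightarrow> real \<Rightarrow> real" where d: "\<And>n. d n \<in> mspace ?m"
    and dense: "\<And>f e. f \<in> mspace ?m \<Longrightarrow> e > 0 \<Longrightarrow> \<exists>n. mdist ?m (d n) f < e"
    using path_space_dense_sequence[OF tT(1)] by blast
  obtain \<kappa> where \<kappa>: "regular_cond_law M (F t) (borel_of_metric ?m) ?Y \<kappa>"
    by (rule ex_regular_cond_law[OF mcomplete_path_space d dense F Y_meas])
  have \<kappa>_meas: "\<kappa> \<in> F t \<rightarrow>\<^sub>M prob_algebra (borel_of_metric ?m)"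
    using \<kappa> by (auto simp: regular_cond_law_def)
  have ball_pos: "AE \<omega> in M. \<bar>d n t - Y t \<omega>\<bar> < r \<longrightarrow> emeasure (\<kappa> \<omega>) (mball_of ?m (d n) r) \<noteq> 0"
    for n and r :: real
  proof -
    let ?B = "mball_of ?m (d n) r"
    have B: "?B \<in> sets (borel_of_metric ?m)" by (intro openin_borel_of_metric openin_mball_of)
    have em[measurable]: "(\<lambda>\<omega>. emeasure (\<kappa> \<omega>) ?B) \<in> borel_measurable (F t)"
      by (rule measurable_compose[OF measurable_prob_algebraD[OF \<kappa>_meas]
          measurable_emeasure_subprob_algebra[OF B]])
    define A where "A = {\<omega> \<in> space (F t). \<bar>d n t - Y t \<omega>\<bar> < r \<and> emeasure (\<kappa> \<omega>) ?B = 0}"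
    have A: "A \<in> sets (F t)" unfolding A_def by measurable
    have "emeasure M A = 0"
    proof (rule ccontr)
      assume "emeasure M A \<noteq> 0"
      \<comment> \<open>On \<open>Aj j\<close> the starting values differ by less than
        \<open>r - 2 / Suc j\<close>, and the increments are allowed the error
        \<open>1 / Suc j\<close>. The total is at most \<open>r - 1 / Suc j\<close>, so the path
        lies in the open ball.\<close>
      define Aj where "Aj j = A \<inter> {\<omega> \<in> space (F t). \<bar>d n t - Y t \<omega>\<bar> < r - 2 / Suc j}" for j
      have Aj: "Aj j \<in> sets (F t)" for j unfolding Aj_def using A by measurable
      have "A = (\<Union>j. Aj j)"
      proof (intro equalityI subsetI)
        fix \<omega> assume \<omega>: "\<omega> \<in> A"
        then have "(r - \<bar>d n t - Y t \<omega>\<bar>) / 2 > 0" by (simp add: A_def)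
        then obtain j where "1 / real (Suc j) < (r - \<bar>d n t - Y t \<omega>\<bar>) / 2" using nat_approx_posE by blast
        then have "\<bar>d n t - Y t \<omega>\<bar> < r - 2 / Suc j" by (simp add: field_simps)
        then show "\<omega> \<in> (\<Union>j. Aj j)" using \<omega> by (auto simp: Aj_def A_def)
      qed (auto simp: Aj_def)
      then obtain j where j: "emeasure M (Aj j) > 0"
        using emeasure_UN_posD[of M Aj] \<open>emeasure M A \<noteq> 0\<close> FM[OF Aj] by (metis not_gr_zero)
      let ?x = "\<lambda>u. d n u - d n t"
      let ?S = "{\<omega> \<in> space M. \<forall>u\<in>{t..T}. \<bar>Y u \<omega> - Y t \<omega> - ?x u\<bar> \<le> 1 / Suc j}"
      have dn: "continuous_on {t..T} (d n)" using d mspace_path_space by blast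
      have "continuous_on {t..T} ?x" by (intro continuous_intros dn)
      then have "emeasure M (Aj j \<inter> ?S) > 0"
        using small[unfolded small_ball_property_def, rule_format, OF t Aj j] by simp
      moreover have "Aj j \<inter> ?S \<subseteq> A \<inter> (?Y -` ?B \<inter> space M)"
      proof (intro subsetI IntI)
        fix \<omega> assume \<omega>: "\<omega> \<in> Aj j \<inter> ?S"
        then have Y\<omega>: "?Y \<omega> \<in> mspace ?m" using measurable_space[OF Y_meas] by auto
        have "\<bar>d n u - ?Y \<omega> u\<bar> \<le> r - 1 / Suc j" if u: "u \<in> {t..T}" for u
        proof -
          have "\<bar>Y u \<omega> - Y t \<omega> - ?x u\<bar> \<le> 1 / Suc j" using \<omega> u by blast
          moreover have "\<bar>d n t - Y t \<omega>\<bar> < r - 2 / Suc j" using \<omega> by (auto simp: Aj_def)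
          moreover have "2 / real (Suc j) = 1 / Suc j + 1 / Suc j" by simp
          ultimately have "\<bar>d n u - Y u \<omega>\<bar> \<le> r - 1 / Suc j" by linarith
          then show ?thesis using u by simp
        qed
        then have "mdist ?m (d n) (?Y \<omega>) \<le> r - 1 / Suc j"
          using mdist_path_space_le[OF tT(2) d Y\<omega>] by blast
        moreover have "1 / real (Suc j) > 0" by simp
        ultimately have "mdist ?m (d n) (?Y \<omega>) < r" by linarith
        then show "\<omega> \<in> ?Y -` ?B" using d Y\<omega> by simp
      qed (auto simp: Aj_def)
      moreover have "A \<inter> (?Y -` ?B \<inter> space M) \<in> sets M"
        using FM[OF A] measurable_sets[OF Y_meas B] by blast
      ultimately have "0 < emeasure M (A \<inter> (?Y -` ?B \<inter> space M))"
        by (rule emeasure_pos_mono)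
      moreover have "emeasure M (A \<inter> (?Y -` ?B \<inter> space M))
          = (\<integral>\<^sup>+\<omega>. emeasure (\<kappa> \<omega>) ?B * indicator A \<omega> \<partial>M)"
        by (rule regular_cond_law_integral[symmetric, OF \<kappa> B A])
      moreover have "\<dots> = (\<integral>\<^sup>+\<omega>. 0 \<partial>M)"
        by (rule nn_integral_cong) (auto simp: A_def indicator_def)
      ultimately show False by simp
    qed
    then have "AE \<omega> in M. \<omega> \<notin> A"
      using FM[OF A] by (simp add: AE_iff_null_sets[symmetric] null_sets_def)
    with AE_space show ?thesis by eventually_elim (auto simp: A_def spF)
  qed
  have "AE \<omega> in M. \<forall>n k. \<bar>d n t - Y t \<omega>\<bar> < 1 / real (Suc k) \<longrightarrow>
      emeasure (\<kappa> \<omega>) (mball_of ?m (d n) (1 / real (Suc k))) \<noteq> 0"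
    unfolding AE_all_countable using ball_pos by blast
  with AE_space regular_cond_law_eval[OF M tT(1) \<kappa> Yt]
  have "AE \<omega> in M. is_support ?m (\<kappa> \<omega>) (paths_from UNIV t T (Y t \<omega>))"
  proof eventually_elim
    case (elim \<omega>)
    then have K: "prob_space (\<kappa> \<omega>)" "sets (\<kappa> \<omega>) = sets (borel_of_metric ?m)"
      using measurable_space[OF \<kappa>_meas] by (auto simp: space_prob_algebra spF)
    have sp: "space (\<kappa> \<omega>) = mspace ?m" using sets_eq_imp_space_eq[OF K(2)] by simp
    show ?case
      unfolding is_support_def
    proof (intro conjI allI impI)
      show "closedin (mtopology_of ?m) (paths_from UNIV t T (Y t \<omega>))"
        using closedin_path_space_eval[of "{Y t \<omega>}" t t T] tT by (simp add: paths_from_def)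
      show "emeasure (\<kappa> \<omega>) (paths_from UNIV t T (Y t \<omega>)) = 1" using elim by simp
      fix C assume C: "closedin (mtopology_of ?m) C \<and> emeasure (\<kappa> \<omega>) C = 1"
      then have CM: "C \<in> sets (\<kappa> \<omega>)" by (simp add: K(2) closedin_borel_of_metric)
      have zero: "emeasure (\<kappa> \<omega>) (mspace ?m - C) = 0"
        using emeasure_compl[OF CM] C prob_space.emeasure_space_1[OF K(1)] by (simp add: sp)
      show "paths_from UNIV t T (Y t \<omega>) \<subseteq> C"
      proof (rule subsetI, rule ccontr)
        fix f assume "f \<in> paths_from UNIV t T (Y t \<omega>)" and fC: "f \<notin> C"
        then have f: "f \<in> mspace ?m" "f t = Y t \<omega>" by (auto simp: paths_from_def)
        have "openin (mtopology_of ?m) (mspace ?m - C)" using C by (simp add: closedin_def)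
        then obtain e where e: "e > 0" "mball_of ?m f e \<subseteq> mspace ?m - C"
          using f fC unfolding openin_mtopology_of_iff by blast
        \<comment> \<open>A radius below \<open>e / 2\<close> keeps the ball around
          \<open>d n\<close> within \<open>e\<close> of \<open>f\<close>; closeness of
          \<open>d n\<close> to \<open>f\<close> at time \<open>t\<close> is the condition under
          which the kernel charges that ball.\<close>
        obtain k where k: "1 / real (Suc k) < e / 2" using nat_approx_posE[of "e / 2"] e(1) by auto
        obtain n where n: "mdist ?m (d n) f < 1 / real (Suc k)"
          using dense[OF f(1), of "1 / real (Suc k)"] by auto
        then have "\<bar>d n t - Y t \<omega>\<bar> < 1 / real (Suc k)"
          using path_space_eval_le[OF d f(1) tT(4), of n] f(2) by simp
        then have "0 < emeasure (\<kappa> \<omega>) (mball_of ?m (d n) (1 / real (Suc k)))"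
          using elim by (simp add: zero_less_iff_neq_zero)
        moreover have "mball_of ?m (d n) (1 / real (Suc k)) \<subseteq> mspace ?m - C"
        proof (rule order_trans[OF subsetI e(2)])
          fix z assume z: "z \<in> mball_of ?m (d n) (1 / real (Suc k))"
          then have "mdist ?m f z \<le> mdist ?m (d n) f + mdist ?m (d n) z"
            using S.triangle[of f "d n" z] f S.commute[of f "d n"] d by auto
          moreover have "mdist ?m (d n) z < 1 / real (Suc k)" using z by simp
          ultimately have "mdist ?m f z < e" using n k by linarith
          then show "z \<in> mball_of ?m f e" using z f by simp
        qed
        moreover have "mspace ?m - C \<in> sets (\<kappa> \<omega>)"
          using sets.compl_sets[OF CM] by (simp add: sp)
        ultimately have "0 < emeasure (\<kappa> \<omega>) (mspace ?m - C)" by (rule emeasure_pos_mono)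
        then show False using zero by simp
      qed
    qed
  qed
  with \<kappa> show "\<exists>\<kappa>. regular_cond_law M (F t) (borel_of_metric ?m) ?Y \<kappa> \<and>
      (AE \<omega> in M. is_support ?m (\<kappa> \<omega>) (paths_from UNIV t T (Y t \<omega>)))" by blast
qed auto

subsection \<open>Independence and natural filtrations\<close>

lemma measurable_diagonal:
  assumes A: "subalgebra M A" and B: "subalgebra M B"
  shows "(\<lambda>\<omega>. (\<omega>, \<omega>)) \<in> M \<rightarrow>\<^sub>M A \<Otimes>\<^sub>M B"
proof -
  have "(\<lambda>\<omega>. \<omega>) \<in> M \<rightarrow>\<^sub>M A" "(\<lambda>\<omega>. \<omega>) \<in> M \<rightarrow>\<^sub>M B"
    using A B by (auto simp: subalgebra_def measurable_def Int_absorb2 dest: sets.sets_into_space)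
  then show ?thesis by (rule measurable_Pair)
qed

text \<open>Independence means that the diagonal map sends \<open>M\<close> to the product of its restrictions to the two
  subalgebras, so Fubini applies.\<close>

lemma (in prob_space) indep_diagonal_null_iff:
  assumes A: "subalgebra M A" and B: "subalgebra M B"
    and ind: "\<And>a b. a \<in> sets A \<Longrightarrow> b \<in> sets B \<Longrightarrow> emeasure M (a \<inter> b) = emeasure M a * emeasure M b"
    and E: "E \<in> sets (A \<Otimes>\<^sub>M B)"
  shows "emeasure M {\<omega> \<in> space M. (\<omega>, \<omega>) \<in> E} = 0 \<longleftrightarrow>
    (AE \<omega> in M. emeasure M ((\<lambda>\<omega>'. (\<omega>', \<omega>)) -` E) = 0)"
proof -
  have diag: "(\<lambda>\<omega>. (\<omega>, \<omega>)) \<in> M \<rightarrow>\<^sub>M A \<Otimes>\<^sub>M B"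
    by (rule measurable_diagonal[OF A B])
  let ?A = "restr_to_subalg M A" and ?B = "restr_to_subalg M B"
  interpret A: prob_space ?A by (rule prob_space_restr_to_subalg[OF A prob_space_axioms])
  interpret B: prob_space ?B by (rule prob_space_restr_to_subalg[OF B prob_space_axioms])
  have sA: "sets ?A = sets A" and sB: "sets ?B = sets B"
    by (simp_all add: sets_restr_to_subalg A B)
  have sAB: "sets (?A \<Otimes>\<^sub>M ?B) = sets (A \<Otimes>\<^sub>M B)"
    by (rule sets_pair_measure_cong[OF sA sB])
  have eq: "?A \<Otimes>\<^sub>M ?B = distr M (A \<Otimes>\<^sub>M B) (\<lambda>\<omega>. (\<omega>, \<omega>))"
  proof (rule pair_measure_eqI)
    show "sigma_finite_measure ?A" "sigma_finite_measure ?B" by unfold_locales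
    show "sets (?A \<Otimes>\<^sub>M ?B) = sets (distr M (A \<Otimes>\<^sub>M B) (\<lambda>\<omega>. (\<omega>, \<omega>)))" by (simp add: sAB)
    fix a b assume "a \<in> sets ?A" "b \<in> sets ?B"
    then have ab: "a \<in> sets A" "b \<in> sets B" by (simp_all add: sA sB)
    then have "a \<in> sets M" using A by (auto simp: subalgebra_def)
    then have "(\<lambda>\<omega>. (\<omega>, \<omega>)) -` (a \<times> b) \<inter> space M = a \<inter> b"
      using sets.sets_into_space by blast
    then show "emeasure ?A a * emeasure ?B b = emeasure (distr M (A \<Otimes>\<^sub>M B) (\<lambda>\<omega>. (\<omega>, \<omega>))) (a \<times> b)"
      using ab ind by (simp add: emeasure_restr_to_subalg[OF A] emeasure_restr_to_subalg[OF B]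
          emeasure_distr[OF diag])
  qed
  have sec: "(\<lambda>\<omega>'. (\<omega>', \<omega>)) -` E \<in> sets A" for \<omega> by (rule sets_Pair2[OF E])
  interpret AB: pair_sigma_finite ?A ?B by unfold_locales
  have E': "E \<in> sets (?A \<Otimes>\<^sub>M ?B)" using E by (simp add: sAB)
  have "{\<omega> \<in> space M. (\<omega>, \<omega>) \<in> E} = (\<lambda>\<omega>. (\<omega>, \<omega>)) -` E \<inter> space M" by auto
  then have "emeasure M {\<omega> \<in> space M. (\<omega>, \<omega>) \<in> E} = emeasure (?A \<Otimes>\<^sub>M ?B) E"
    unfolding eq using emeasure_distr[OF diag E] by simp
  also have "\<dots> = (\<integral>\<^sup>+\<omega>. emeasure M ((\<lambda>\<omega>'. (\<omega>', \<omega>)) -` E) \<partial>?B)"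
    unfolding AB.emeasure_pair_measure_alt2[OF E'] by (simp add: emeasure_restr_to_subalg[OF A sec])
  finally have int: "emeasure M {\<omega> \<in> space M. (\<omega>, \<omega>) \<in> E} = (\<integral>\<^sup>+\<omega>. emeasure M ((\<lambda>\<omega>'. (\<omega>', \<omega>)) -` E) \<partial>?B)" .
  have meas: "(\<lambda>\<omega>. emeasure M ((\<lambda>\<omega>'. (\<omega>', \<omega>)) -` E)) \<in> borel_measurable ?B"
    using AB.measurable_emeasure_Pair2[OF E'] by (simp add: emeasure_restr_to_subalg[OF A sec])
  \<comment> \<open>The mass of the section is \<open>B\<close>-measurable, so its integral over the
    restricted measure is its integral over \<open>M\<close>, and vanishing becomes an almost sure
    statement in \<open>M\<close>.\<close>
  then have "(\<lambda>\<omega>. emeasure M ((\<lambda>\<omega>'. (\<omega>', \<omega>)) -` E)) \<in> borel_measurable B"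
    using measurable_cong_sets[OF sB refl] by blast
  from nn_integral_subalgebra2[OF B this] measurable_from_subalg[OF B this] int
  show "emeasure M {\<omega> \<in> space M. (\<omega>, \<omega>) \<in> E} = 0 \<longleftrightarrow> (AE \<omega> in M. emeasure M ((\<lambda>\<omega>'. (\<omega>', \<omega>)) -` E) = 0)"
    by (simp add: nn_integral_0_iff_AE)
qed

section \<open>Natural filtrations\<close>

lemma space_natural_filtration [simp]: "space (natural_filtration M Y t) = space M"
  unfolding natural_filtration_def by (rule space_measure_of) auto

lemma sets_natural_filtration:
  "sets (natural_filtration M Y t) =
     sigma_sets (space M) {Y s -` A \<inter> space M | s A. s \<in> {0..t} \<and> A \<in> sets borel}"
  unfolding natural_filtration_def by (rule sets_measure_of) auto

lemma measurable_natural_filtration: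
  "s \<in> {0..t} \<Longrightarrow> Y s \<in> borel_measurable (natural_filtration M Y t)"
  by (rule measurableI) (auto simp: sets_natural_filtration intro!: sigma_sets.Basic)

lemma sets_natural_filtration_subset:
  assumes "space G = space M" "\<And>s. s \<in> {0..t} \<Longrightarrow> Y s \<in> borel_measurable G"
  shows "sets (natural_filtration M Y t) \<subseteq> sets G"
proof -
  have "{Y s -` A \<inter> space M | s A. s \<in> {0..t} \<and> A \<in> sets borel} \<subseteq> sets G"
    using assms measurable_sets[of _ G borel] by fastforce
  then show ?thesis
    unfolding sets_natural_filtration assms(1)[symmetric] by (rule sets.sigma_sets_subset)
qed

lemma filtration_upto_natural_filtration:
  assumes "\<And>s. s \<in> {0..T} \<Longrightarrow> Y s \<in> borel_measurable M"
  shows "filtration_upto M T (natural_filtration M Y)"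
  unfolding filtration_upto_def subalgebra_def
  by (intro ballI conjI impI sets_natural_filtration_subset)
    (use assms in \<open>auto intro: measurable_natural_filtration\<close>)

text \<open>The integral has to compensate \<open>h\<close>: after \<open>t\<close> its increments
  should follow \<open>x0 - (h - h t)\<close>. Surjectivity provides an integrator with exactly
  these increments, and the Lipschitz bound turns closeness of \<open>y\<close> to it after
  \<open>t\<close> into closeness of the integrals, whatever the continuous path \<open>y\<close>
  did before.\<close>

lemma RS_integral_small_ball_pullback:
  assumes t: "t \<in> {0..<T}" and f: "variation_dominated f W 0 T"
    and c: "c > 0" "\<And>s. s \<in> {0..T} \<Longrightarrow> c \<le> \<bar>f s\<bar>"
    and h: "continuous_on {0..T} h" and x0: "continuous_on {t..T} x0" "x0 t = 0" and \<delta>: "\<delta> > 0"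
  obtains x \<eta> where "\<eta> > 0" "continuous_on {t..T} x" "x t = 0"
    "\<forall>y. continuous_on {0..T} y \<longrightarrow> (\<forall>u\<in>{t..T}. \<bar>y u - y t - x u\<bar> \<le> \<eta>) \<longrightarrow>
      (\<forall>u\<in>{t..T}. \<bar>(h u + RS_integral f y 0 u) - (h t + RS_integral f y 0 t) - x0 u\<bar> \<le> \<delta>)"
proof -
  have T: "0 \<le> T" "0 \<le> t" "t \<le> T" using t by auto
  \<comment> \<open>On {0..t} the target is held at its value at time \<open>t\<close>, which is 0
    because \<open>x0 t = 0\<close>; this keeps it continuous on the whole interval.\<close>
  define g where "g s = x0 (max t s) - (h (max t s) - h t)" for s
  have mx: "continuous_on {0..T} (\<lambda>s. max t s)" by (intro continuous_intros)
  have "continuous_on {0..T} (\<lambda>s. x0 (max t s))"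
    by (rule continuous_on_compose2[OF x0(1) mx]) (use T in auto)
  moreover have "continuous_on {0..T} (\<lambda>s. h (max t s))"
    by (rule continuous_on_compose2[OF h mx]) (use T in auto)
  ultimately have g: "continuous_on {0..T} g"
    unfolding g_def by (intro continuous_intros)
  obtain \<xi> where \<xi>: "continuous_on {0..T} \<xi>"
    "\<And>s. s \<in> {0..T} \<Longrightarrow> RS_integral f \<xi> 0 s = g s - g 0"
    using RS_integral_surj[OF T(1) f g c] by blast
  define C where "C = \<bar>f 0\<bar> + 4 * (W T - W 0)"
  have C: "C \<ge> 0" using variation_dominated_mono[OF f, of 0 T] T by (simp add: C_def)
  \<comment> \<open>\<open>C\<close> is the Lipschitz constant of the integral; with
    \<open>C + 1\<close> the quotient needs only \<open>C \<ge> 0\<close> to be positive.\<close>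
  define \<eta> where "\<eta> = \<delta> / (C + 1)"
  have \<eta>0: "\<eta> > 0" and "(C + 1) * \<eta> = \<delta>" using \<delta> C by (simp_all add: \<eta>_def)
  then have \<eta>: "\<eta> > 0" "C * \<eta> \<le> \<delta>" by (simp_all add: distrib_right)
  show thesis
  proof (rule that[of \<eta> "\<lambda>u. \<xi> u - \<xi> t"]; (intro allI impI ballI)?)
    show "\<eta> > 0" by (rule \<eta>)
    show "continuous_on {t..T} (\<lambda>u. \<xi> u - \<xi> t)"
      by (intro continuous_intros continuous_on_subset[OF \<xi>(1)]) (use T in auto)
    show "\<xi> t - \<xi> t = 0" by simp
    fix y u assume y: "continuous_on {0..T} y" and u: "u \<in> {t..T}"
      and near: "\<forall>u\<in>{t..T}. \<bar>y u - y t - (\<xi> u - \<xi> t)\<bar> \<le> \<eta>"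
    have "\<bar>(RS_integral f y 0 u - RS_integral f y 0 t) - (RS_integral f \<xi> 0 u - RS_integral f \<xi> 0 t)\<bar>
        \<le> (\<bar>f 0\<bar> + 4 * (W T - W 0)) * \<eta>"
      by (rule RS_integral_Lipschitz[OF f y \<xi>(1)]) (use T u near in auto)
    moreover have "RS_integral f \<xi> 0 u - RS_integral f \<xi> 0 t = x0 u - (h u - h t)"
      using \<xi>(2)[of u] \<xi>(2)[of t] u T x0(2) by (simp add: g_def max_def)
    ultimately show "\<bar>(h u + RS_integral f y 0 u) - (h t + RS_integral f y 0 t) - x0 u\<bar> \<le> \<delta>"
      using \<eta>(2) unfolding C_def by linarith
  qed
qed

theorem theorem3p18:
  fixes M :: "'a measure" and T :: real and H k X :: "real \<Rightarrow> 'a \<Rightarrow> real"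
  assumes "prob_space M" and "complete_measure M" and "T > 0"
    and "continuous_process M T UNIV H"
    and "(\<lambda>(t, \<omega>). k t \<omega>) \<in> borel_measurable (restrict_space borel {0..T} \<Otimes>\<^sub>M M)"
    and "\<And>\<omega>. \<omega> \<in> space M \<Longrightarrow> finite_variation_on (\<lambda>t. k t \<omega>) 0 T"
    and "continuous_process M T UNIV X"
    and "prob_space.indep_set M
           (sets (vimage_algebra (space M) (\<lambda>\<omega>. \<lambda>t\<in>{0..T}. X t \<omega>)
             (\<Pi>\<^sub>M t\<in>{0..T}. borel)))
           (sets (vimage_algebra (space M) (\<lambda>\<omega>. \<lambda>t\<in>{0..T}. (H t \<omega>, k t \<omega>))
             (\<Pi>\<^sub>M t\<in>{0..T}. borel \<Otimes>\<^sub>M borel)))"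
    and "has_CFS M T UNIV (natural_filtration M X) X"
    and "AE \<omega> in M. (INF t\<in>{0..T}. \<bar>k t \<omega>\<bar>) > 0"
  defines "Z \<equiv> \<lambda>t \<omega>. H t \<omega> + RS_integral (\<lambda>s. k s \<omega>) (\<lambda>s. X s \<omega>) 0 t"
  shows "has_CFS M T UNIV (natural_filtration M Z) Z"
proof -
  interpret prob_space M by (rule assms(1))
  let ?XV = "vimage_algebra (space M) (\<lambda>\<omega>. \<lambda>t\<in>{0..T}. X t \<omega>) (\<Pi>\<^sub>M t\<in>{0..T}. borel)"
  let ?FX = "natural_filtration M X"
  \<comment> \<open>\<open>K\<close> carries the whole paths of \<open>H\<close> and
    \<open>k\<close>, including times after the conditioning time: independence allows all of it to
    be frozen.\<close>
  define K where "K = vimage_algebra (space M) (\<lambda>\<omega>. \<lambda>t\<in>{0..T}. (H t \<omega>, k t \<omega>))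
             (\<Pi>\<^sub>M t\<in>{0..T}. (borel :: real measure) \<Otimes>\<^sub>M (borel :: real measure))"
  have indep: "indep_set (sets ?XV) (sets K)" unfolding K_def by (rule assms(8))
  have spK: "space K = space M" by (simp add: K_def)
  have subK: "subalgebra M K"
    using indep_setD_ev2[OF indep] spK by (simp add: subalgebra_def)
  have X_XV: "X s \<in> borel_measurable ?XV" if s: "s \<in> {0..T}" for s
  proof -
    have "(\<lambda>\<omega>. \<lambda>t\<in>{0..T}. X t \<omega>) \<in> ?XV \<rightarrow>\<^sub>M (\<Pi>\<^sub>M t\<in>{0..T}. borel)"
      by (rule measurable_vimage_algebra1) (auto simp: space_PiM)
    from measurable_compose[OF this measurable_component_singleton[OF s]] s show ?thesis by simp
  qed
  have HK: "(\<lambda>\<omega>. (H s \<omega>, k s \<omega>)) \<in> K \<rightarrow>\<^sub>M borel \<Otimes>\<^sub>M borel" if s: "s \<in> {0..T}" for s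
  proof -
    have "(\<lambda>\<omega>. \<lambda>t\<in>{0..T}. (H t \<omega>, k t \<omega>)) \<in> K \<rightarrow>\<^sub>M (\<Pi>\<^sub>M t\<in>{0..T}. borel \<Otimes>\<^sub>M borel)"
      unfolding K_def by (rule measurable_vimage_algebra1) (auto simp: space_PiM space_pair_measure)
    from measurable_compose[OF this measurable_component_singleton[OF s]] s show ?thesis by simp
  qed
  have H_K: "H s \<in> borel_measurable K" and k_K: "k s \<in> borel_measurable K" if s: "s \<in> {0..T}" for s
    using measurable_compose[OF HK[OF s] measurable_fst] measurable_compose[OF HK[OF s] measurable_snd] by simp_all
  have FX_XV: "sets (?FX t) \<subseteq> sets ?XV" if "t \<le> T" for t
    using that by (intro sets_natural_filtration_subset X_XV) auto
  have X_cont: "continuous_on {0..T} (\<lambda>s. X s \<omega>)" and H_cont: "continuous_on {0..T} (\<lambda>s. H s \<omega>)"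
    if "\<omega> \<in> space M" for \<omega>
    using assms(4,7) that by (auto simp: continuous_process_def)
  have subFX: "subalgebra M (?FX t)" if "t \<le> T" for t
    using FX_XV[OF that] indep_setD_ev1[OF indep] by (auto simp: subalgebra_def)
  have ind: "emeasure M (a \<inter> b) = emeasure M a * emeasure M b"
    if "a \<in> sets (?FX t)" "b \<in> sets K" "t \<le> T" for a b t
  proof -
    have "prob (a \<inter> b) = prob a * prob b"
      using indep_setD[OF indep] FX_XV that by blast
    then show ?thesis by (simp add: emeasure_eq_measure ennreal_mult)
  qed
  have diag: "(\<lambda>\<omega>. (\<omega>, \<omega>)) \<in> M \<rightarrow>\<^sub>M ?FX t \<Otimes>\<^sub>M K" if "t \<le> T" for t
    using that by (intro measurable_diagonal subFX subK)
  have null_iff: "emeasure M {\<omega> \<in> space M. (\<omega>, \<omega>) \<in> E} = 0 \<longleftrightarrow>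
      (AE \<omega> in M. emeasure M ((\<lambda>\<omega>'. (\<omega>', \<omega>)) -` E) = 0)"
    if "E \<in> sets (?FX t \<Otimes>\<^sub>M K)" "t \<le> T" for E t
    by (rule indep_diagonal_null_iff[OF subFX[OF that(2)] subK _ that(1)]) (rule ind[OF _ _ that(2)])
  \<comment> \<open>Decoupled version of \<open>Z\<close>: the path of \<open>X\<close> is read at
    the first coordinate, \<open>H\<close> and \<open>k\<close> at the second. \<open>Z\<close> is
    its restriction to the diagonal.\<close>
  define Zp where "Zp u p = H u (snd p) + RS_integral (\<lambda>s. k s (snd p)) (\<lambda>s. X s (fst p)) 0 u" for u p
  have Z_Zp: "Z u \<omega> = Zp u (\<omega>, \<omega>)" for u \<omega> by (simp add: Z_def Zp_def)
  have Zp_cont: "continuous_on {0..T} (\<lambda>u. Zp u p)" if p: "fst p \<in> space M" "snd p \<in> space M" for p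
  proof -
    obtain W where W: "variation_dominated (\<lambda>s. k s (snd p)) W 0 T"
      using finite_variation_on_imp_dominated[OF assms(6)[OF p(2)]] by blast
    show ?thesis
      unfolding Zp_def by (intro continuous_on_add H_cont p continuous_on_RS_integral[OF W] X_cont)
  qed
  \<comment> \<open>Only \<open>X\<close> is restricted to times up to \<open>t\<close>, since
    \<open>K\<close> knows \<open>H\<close> and \<open>k\<close> at all times. The dominating
    \<open>W\<close> varies with the path, but the approximating sums do not involve it.\<close>
  have Zp_meas: "Zp u \<in> borel_measurable (?FX t \<Otimes>\<^sub>M K)" if u: "u \<in> {0..t}" and tT: "t \<le> T" for u t
  proof -
    have [measurable]: "X s \<in> borel_measurable (?FX t)" if "s \<in> {0..u}" for s
      using that u by (intro measurable_natural_filtration) auto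
    have pt: "u * (real i / real n) \<in> {0..u}" if "i \<le> n" for i n
    proof -
      have "real i / real n \<le> 1" using that by (auto simp: divide_le_eq_1)
      then have "u * (real i / real n) \<le> u * 1" using u by (intro mult_left_mono) auto
      then show ?thesis using u by simp
    qed
    have "(\<lambda>p. RS_integral (\<lambda>s. k s (snd p)) (\<lambda>s. X s (fst p)) 0 u) \<in> borel_measurable (?FX t \<Otimes>\<^sub>M K)"
    proof (rule borel_measurable_LIMSEQ_real)
      fix p assume "p \<in> space (?FX t \<Otimes>\<^sub>M K)"
      then have p: "fst p \<in> space M" "snd p \<in> space M" by (auto simp: space_pair_measure spK)
      obtain W where W: "variation_dominated (\<lambda>s. k s (snd p)) W 0 T"
        using finite_variation_on_imp_dominated[OF assms(6)[OF p(2)]] by blast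
      show "(\<lambda>n. \<Sum>i<n. k (u * (Suc i / n)) (snd p) * (X (u * (Suc i / n)) (fst p) - X (u * (i / n)) (fst p)))
          \<longlonglongrightarrow> RS_integral (\<lambda>s. k s (snd p)) (\<lambda>s. X s (fst p)) 0 u"
      proof (rule RS_sums_tendsto[where f="\<lambda>s. k s (snd p)" and g="\<lambda>s. X s (fst p)"])
        show "variation_dominated (\<lambda>s. k s (snd p)) W 0 u"
          by (rule variation_dominated_subinterval[OF W]) (use u tT in auto)
        show "continuous_on {0..u} (\<lambda>s. X s (fst p))"
          by (rule continuous_on_subset[OF X_cont[OF p(1)]]) (use u tT in auto)
      qed (use u in simp)
    next
      fix n
      show "(\<lambda>p. \<Sum>i<n. k (u * (Suc i / n)) (snd p) * (X (u * (Suc i / n)) (fst p) - X (u * (i / n)) (fst p)))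
          \<in> borel_measurable (?FX t \<Otimes>\<^sub>M K)"
      proof (intro borel_measurable_sum borel_measurable_times borel_measurable_diff)
        fix i assume i: "i \<in> {..<n}"
        then have s: "u * (real (Suc i) / n) \<in> {0..u}" "u * (real i / n) \<in> {0..u}"
          using pt[of "Suc i" n] pt[of i n] by simp_all
        show "(\<lambda>p. k (u * (Suc i / n)) (snd p)) \<in> borel_measurable (?FX t \<Otimes>\<^sub>M K)"
          using s u tT by (intro measurable_compose[OF measurable_snd] k_K) auto
        show "(\<lambda>p. X (u * (Suc i / n)) (fst p)) \<in> borel_measurable (?FX t \<Otimes>\<^sub>M K)"
          "(\<lambda>p. X (u * (i / n)) (fst p)) \<in> borel_measurable (?FX t \<Otimes>\<^sub>M K)"
          using s u by (auto intro!: measurable_compose[OF measurable_fst] measurable_natural_filtration)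
      qed
    qed
    moreover have "(\<lambda>p. H u (snd p)) \<in> borel_measurable (?FX t \<Otimes>\<^sub>M K)"
      using u tT by (intro measurable_compose[OF measurable_snd] H_K) auto
    ultimately show ?thesis
      unfolding Zp_def[abs_def] by (intro borel_measurable_add)
  qed
  have Z_meas: "Z u \<in> borel_measurable M" if "u \<in> {0..T}" for u
    using measurable_compose[OF diag[OF order_refl] Zp_meas[OF that order_refl]]
    by (simp add: Z_Zp[abs_def])
  have Z_proc: "continuous_process M T UNIV Z"
    using Z_meas Zp_cont by (simp add: continuous_process_def Z_Zp)
  have small: "small_ball_property M T (natural_filtration M Z) Z"
    unfolding small_ball_property_def
  proof (intro ballI allI impI)
    fix t A and x :: "real \<Rightarrow> real" and \<delta> :: real
    assume t: "t \<in> {0..<T}" and A: "A \<in> sets (natural_filtration M Z t)" and A_pos: "emeasure M A > 0"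
      and x: "continuous_on {t..T} x" "x t = 0" and \<delta>: "\<delta> > 0"
    have tT: "t \<le> T" "0 \<le> t" using t by auto
    have diag_sp: "(\<lambda>\<omega>. (\<omega>, \<omega>)) \<in> space M \<rightarrow> space (?FX t \<Otimes>\<^sub>M K)"
      by (auto simp: space_pair_measure spK)
    let ?V = "vimage_algebra (space M) (\<lambda>\<omega>. (\<omega>, \<omega>)) (?FX t \<Otimes>\<^sub>M K)"
    \<comment> \<open>The pullback along the diagonal makes every \<open>Z s\<close> with
      \<open>s\<close> up to \<open>t\<close> measurable, so every event of the past of
      \<open>Z\<close> is the trace of a product set.\<close>
    have "sets (natural_filtration M Z t) \<subseteq> sets ?V"
    proof (rule sets_natural_filtration_subset)
      fix s assume "s \<in> {0..t}"
      from measurable_compose[OF measurable_vimage_algebra1[OF diag_sp] Zp_meas[OF this tT(1)]]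
      show "Z s \<in> borel_measurable ?V" by (simp add: Z_Zp[abs_def])
    qed simp
    then obtain A' where A': "A' \<in> sets (?FX t \<Otimes>\<^sub>M K)" "A = (\<lambda>\<omega>. (\<omega>, \<omega>)) -` A' \<inter> space M"
      using A unfolding sets_vimage_algebra2[OF diag_sp] by blast
    define B where "B = {p \<in> space (?FX T \<Otimes>\<^sub>M K). \<forall>u\<in>{t..T}. \<bar>Zp u p - Zp t p - x u\<bar> \<le> \<delta>}"
    have B: "B \<in> sets (?FX T \<Otimes>\<^sub>M K)"
      unfolding B_def
    proof (rule sets_all_abs_le_continuous)
      fix s assume "s \<in> {t..T}"
      then show "(\<lambda>p. Zp s p - Zp t p - x s) \<in> borel_measurable (?FX T \<Otimes>\<^sub>M K)"
        using tT by (intro borel_measurable_diff Zp_meas) auto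
    next
      fix p assume "p \<in> space (?FX T \<Otimes>\<^sub>M K)"
      then have "continuous_on {0..T} (\<lambda>u. Zp u p)" by (intro Zp_cont) (auto simp: space_pair_measure spK)
      then have "continuous_on {t..T} (\<lambda>u. Zp u p)" using tT by (auto intro: continuous_on_subset)
      then show "continuous_on {t..T} (\<lambda>s. Zp s p - Zp t p - x s)" by (intro continuous_intros x)
    qed
    have FX_mono: "sets (?FX t) \<subseteq> sets (?FX T)"
      using tT by (intro sets_natural_filtration_subset measurable_natural_filtration) auto
    \<comment> \<open>\<open>B\<close> involves \<open>X\<close> up to \<open>T\<close>, while
      \<open>A'\<close> must remain measurable at \<open>t\<close> for its slices to be events of
      the past of \<open>X\<close>. The identity map carries \<open>A'\<close> into the larger
      product just to form the intersection.\<close>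
    have "(\<lambda>p. (fst p, snd p)) \<in> ?FX T \<Otimes>\<^sub>M K \<rightarrow>\<^sub>M ?FX t \<Otimes>\<^sub>M K"
    proof (rule measurable_Pair)
      have "(\<lambda>\<omega>. \<omega>) \<in> ?FX T \<rightarrow>\<^sub>M ?FX t"
        using FX_mono by (auto simp: measurable_def Int_absorb2 dest: sets.sets_into_space)
      then show "fst \<in> ?FX T \<Otimes>\<^sub>M K \<rightarrow>\<^sub>M ?FX t" by (rule measurable_compose[OF measurable_fst])
    qed simp
    from measurable_sets[OF this A'(1)]
    have "A' \<inter> space (?FX T \<Otimes>\<^sub>M K) \<in> sets (?FX T \<Otimes>\<^sub>M K)" by simp
    moreover have "A' \<subseteq> space (?FX T \<Otimes>\<^sub>M K)"
      using sets.sets_into_space[OF A'(1)] by (simp add: space_pair_measure)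
    ultimately have "A' \<in> sets (?FX T \<Otimes>\<^sub>M K)" by (simp add: Int_absorb2)
    with B have AB: "A' \<inter> B \<in> sets (?FX T \<Otimes>\<^sub>M K)" by blast
    have eq: "A \<inter> {\<omega> \<in> space M. \<forall>u\<in>{t..T}. \<bar>Z u \<omega> - Z t \<omega> - x u\<bar> \<le> \<delta>}
        = {\<omega> \<in> space M. (\<omega>, \<omega>) \<in> A' \<inter> B}"
    proof (rule set_eqI)
      fix \<omega>
      show "\<omega> \<in> A \<inter> {\<omega> \<in> space M. \<forall>u\<in>{t..T}. \<bar>Z u \<omega> - Z t \<omega> - x u\<bar> \<le> \<delta>} \<longleftrightarrow>
          \<omega> \<in> {\<omega> \<in> space M. (\<omega>, \<omega>) \<in> A' \<inter> B}"
        by (simp add: A'(2) B_def Z_Zp space_pair_measure spK) blast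
    qed
    have A_eq: "A = {\<omega> \<in> space M. (\<omega>, \<omega>) \<in> A'}" using A'(2) by auto
    show "emeasure M (A \<inter> {\<omega> \<in> space M. \<forall>u\<in>{t..T}. \<bar>Z u \<omega> - Z t \<omega> - x u\<bar> \<le> \<delta>}) > 0"
    proof (rule ccontr)
      assume "\<not> ?thesis"
      then have "emeasure M {\<omega> \<in> space M. (\<omega>, \<omega>) \<in> A' \<inter> B} = 0"
        unfolding eq not_gr_zero .
      then have "AE \<omega> in M. emeasure M ((\<lambda>\<omega>'. (\<omega>', \<omega>)) -` (A' \<inter> B)) = 0"
        by (rule iffD1[OF null_iff[OF AB order_refl]])
      \<comment> \<open>For almost every frozen \<omega> the slice of \<open>A'\<close> must itself
        be null: otherwise the small ball property of \<open>X\<close> on that slice, with the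
        pulled-back target, would give the slice of \<open>A' \<inter> B\<close> positive mass.
        Reading the equivalence backwards, at time \<open>t\<close>, then makes \<open>A\<close>
        null.\<close>
      with AE_space assms(10) have "AE \<omega> in M. emeasure M ((\<lambda>\<omega>'. (\<omega>', \<omega>)) -` A') = 0"
      proof eventually_elim
        case (elim \<omega>)
        let ?S = "(\<lambda>\<omega>'. (\<omega>', \<omega>)) -` A'"
        obtain W where W: "variation_dominated (\<lambda>s. k s \<omega>) W 0 T"
          using finite_variation_on_imp_dominated[OF assms(6)[OF elim(1)]] by blast
        have k_lower: "(INF t\<in>{0..T}. \<bar>k t \<omega>\<bar>) \<le> \<bar>k s \<omega>\<bar>" if "s \<in> {0..T}" for s
          using that by (intro cINF_lower bdd_belowI[of _ 0]) auto
        obtain x' \<eta> where x': "\<eta> > 0" "continuous_on {t..T} x'" "x' t = 0"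
          and pull: "\<forall>y. continuous_on {0..T} y \<longrightarrow> (\<forall>u\<in>{t..T}. \<bar>y u - y t - x' u\<bar> \<le> \<eta>) \<longrightarrow>
            (\<forall>u\<in>{t..T}. \<bar>(H u \<omega> + RS_integral (\<lambda>s. k s \<omega>) y 0 u)
              - (H t \<omega> + RS_integral (\<lambda>s. k s \<omega>) y 0 t) - x u\<bar> \<le> \<delta>)"
          by (rule RS_integral_small_ball_pullback[OF t W elim(2) k_lower H_cont[OF elim(1)] x \<delta>];
              (assumption | rule that)?)
        \<comment> \<open>Because \<open>A'\<close> was taken in the product at time
          \<open>t\<close>, its slice is an event at which the conditional full support of
          \<open>X\<close> may be tested.\<close>
        have S: "?S \<in> sets (?FX t)" by (rule sets_Pair2[OF A'(1)])
        show ?case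
        proof (rule ccontr)
          assume "emeasure M ?S \<noteq> 0"
          then have "emeasure M ?S > 0" by (simp add: zero_less_iff_neq_zero)
          from has_CFS_imp_small_ball[OF assms(1,9), unfolded small_ball_property_def,
              rule_format, OF t S this x'(2,3,1)]
          have "0 < emeasure M (?S \<inter> {\<omega>' \<in> space M. \<forall>u\<in>{t..T}. \<bar>X u \<omega>' - X t \<omega>' - x' u\<bar> \<le> \<eta>})" .
          moreover have "?S \<inter> {\<omega>' \<in> space M. \<forall>u\<in>{t..T}. \<bar>X u \<omega>' - X t \<omega>' - x' u\<bar> \<le> \<eta>}
              \<subseteq> (\<lambda>\<omega>'. (\<omega>', \<omega>)) -` (A' \<inter> B)"
          proof (intro subsetI vimageI2 IntI)
            fix \<omega>' assume \<omega>': "\<omega>' \<in> ?S \<inter> {\<omega>' \<in> space M. \<forall>u\<in>{t..T}. \<bar>X u \<omega>' - X t \<omega>' - x' u\<bar> \<le> \<eta>}"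
            then show "(\<omega>', \<omega>) \<in> A'" by simp
            have "\<bar>Zp u (\<omega>', \<omega>) - Zp t (\<omega>', \<omega>) - x u\<bar> \<le> \<delta>" if "u \<in> {t..T}" for u
              using pull[rule_format, of "\<lambda>s. X s \<omega>'" u] X_cont[of \<omega>'] \<omega>' that by (simp add: Zp_def)
            then show "(\<omega>', \<omega>) \<in> B"
              using \<omega>' elim(1) by (simp add: B_def space_pair_measure spK)
          qed
          moreover have "(\<lambda>\<omega>'. (\<omega>', \<omega>)) -` (A' \<inter> B) \<in> sets M"
            using sets_Pair2[OF AB] subFX[OF order_refl] by (auto simp: subalgebra_def)
          ultimately have "0 < emeasure M ((\<lambda>\<omega>'. (\<omega>', \<omega>)) -` (A' \<inter> B))" by (rule emeasure_pos_mono)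
          with elim(3) show False by simp
        qed
      qed
      then have "emeasure M A = 0"
        unfolding A_eq
        by (rule iffD2[OF null_iff[OF A'(1) tT(1)]])
      with A_pos show False by simp
    qed
  qed
  show ?thesis
    by (rule small_ball_imp_has_CFS[OF assms(1) Z_proc filtration_upto_natural_filtration[OF Z_meas] _ small])
      (auto intro: measurable_natural_filtration)
qed

end
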